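(* Let $\mathfrak U$ be the set composed of $\{0\}$ and the one-dimensional Lie superalgebra with null even part. Every nilpotent even-symplectic Lie superalgebra is either an element of $\mathfrak U$ or obtained from a finite number of elements of $\mathfrak U$ by a finite sequence of double extensions by the one-dimensional Lie algebra and/or generalized double extensions by the one-dimensional Lie superalgebra with null even part.
   Context: All Lie superalgebras are finite dimensional over an algebraically closed field $\mathbb K$ of characteristic zero; $|x|\in\mathbb Z_2$ is the degree of a homogeneous $X$. A bilinear form $\omega$ on $\mathfrak g$ is even if $\omega(\mathfrak g_\alpha,\mathfrak g_\beta)=\{0\}$ for $\alpha\ne\beta$, and skew-supersymmetric if $\omega(X,Y)=-(-1)^{|x||y|}\omega(Y,X)$. An even-symplectic form is an even, skew-supersymmetric, non-degenerate bilinear form with $(-1)^{|z||x|}\omega(X,[Y,Z])+(-1)^{|x||y|}\omega(Y,[Z,X])+(-1)^{|y||z|}\omega(Z,[X,Y])=0$ for homogeneous $X,Y,Z$; $(\mathfrak g,\omega)$ is then an even-symplectic Lie superalgebra. A superderivation $D$ of degree $d$ is a linear map with $D(\mathfrak g_\alpha)\subseteq\mathfrak g_{\alpha+d}$ and $D[X,Y]=[D(X),Y]+(-1)^{d|x|}[X,D(Y)]$; $D^*$ denotes the map with $\omega(D^*(X),Y)=\omega(X,D(Y))$. Let $(\mathfrak h,\omega_{\mathfrak h})$ be an even-symplectic Lie superalgebra, $D$ a superderivation of $\mathfrak h$ of degree $|e|\in\mathbb Z_2$, and $\mathfrak t=\mathbb Ke^*\oplus\mathfrak h\oplus\mathbb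 Ke$ with $e,e^*$ both of degree $|e|$. Put $\gamma(X,Y)=-(-1)^{|e|}[\omega_{\mathfrak h}(D(X),Y)+(-1)^{|e||x|}\omega_{\mathfrak h}(X,D(Y))]$. Let $\Omega$ be the skew-supersymmetric form on $\mathfrak t$ with $\Omega|_{\mathfrak h\times\mathfrak h}=\omega_{\mathfrak h}$, $\Omega(e^*,e)=1$ and all other pairings zero (except $\Omega(e,e^* )$, given by skew-supersymmetry). - Double extension of $(\mathfrak h,\omega_{\mathfrak h})$ by the one-dimensional Lie algebra, by means of $(D,b_0)$ (case $|e|=\bar0$): $b_0\in\mathfrak h_{\bar0}$ satisfies $-\omega_{\mathfrak h}\bigl([D^*(D+D^* )+(D+D^* )D](X),Y\bigr)=\omega_{\mathfrak h}(b_0,[X,Y]_{\mathfrak h})$ for all $X,Y\in\mathfrak h$; it is $(\mathfrak t,\Omega)$ with $e^*$ central, $[e,e]=0$, $[e,X]=D(X)+\omega_{\mathfrak h}(b_0,X)e^*$, $[X,Y]=[X,Y]_{\mathfrak h}+\gamma(X,Y)e^*$. - Generalized double extension of $(\mathfrak h,\omega_{\mathfrak h})$ by the one-dimensional Lie superalgebra with null even part, by means of $(D,x_0)$ (case $|e|=\bar1$): $x_0\in\mathfrak h_{\bar0}$ satisfies $D(x_0)=0$, $\omega_{\mathfrak h}(x_0,x_0)=0$ and $D^2=\frac12[x_0,\cdot]_{\mathfrak h}$; it is $(\mathfrak t,\Omega)$ with $e^*$ central, $[e,e]=x_0$, $[e,X]=D(X)+\frac12\omega_{\mathfrak h}(x_0,X)e^*$,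 $[X,Y]=[X,Y]_{\mathfrak h}+\gamma(X,Y)e^*$. Both are even-symplectic Lie superalgebras; "is obtained" is understood up to isomorphism of Lie superalgebras preserving the symplectic forms. *)

theory Defs
  imports
    "HOL-Library.Z2"
    "HOL-Library.Product_Plus"
    "HOL-Computational_Algebra.Computational_Algebra"
begin

section \<open>Lie superalgebras\<close>

text \<open>
  Degrees are elements of the type \<^typ>\<open>bit\<close>, the field with two elements. The underlying space of
  a superalgebra is the (internal) direct sum of the subspaces \<open>comp L 0\<close> and \<open>comp L 1\<close> of an ambient
  vector space with carrier type \<open>'a\<close>; it need not be all of that type. The values of the bracket
  and of the form outside the underlying space are irrelevant.
\<close>

record ('k, 'a) superalg =
  smul :: "'k \<Rightarrow> 'a \<Rightarrow> 'a"
  comp :: "bit \<Rightarrow> 'a set"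
  bracket :: "'a \<Rightarrow> 'a \<Rightarrow> 'a"

record ('k, 'a) symp_superalg = "('k, 'a) superalg" +
  form :: "'a \<Rightarrow> 'a \<Rightarrow> 'k"

definition carrier :: "('k, 'a::plus, 'm) superalg_scheme \<Rightarrow> 'a set" where
  "carrier L = {x + y |x y. x \<in> comp L 0 \<and> y \<in> comp L 1}"

text \<open>The sign \<open>(-1)\<^sup>p\<close> for a degree \<open>p\<close>.\<close>

definition sg :: "bit \<Rightarrow> 'k::field" where
  "sg p = (if p = 0 then 1 else - 1)"

definition linear_on ::
  "'a set \<Rightarrow> ('k \<Rightarrow> 'a \<Rightarrow> 'a) \<Rightarrow> ('k \<Rightarrow> 'b \<Rightarrow> 'b) \<Rightarrow> ('a::plus \<Rightarrow> 'b::plus) \<Rightarrow> bool" where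
  "linear_on V s1 s2 f \<longleftrightarrow>
     (\<forall>x\<in>V. \<forall>y\<in>V. f (x + y) = f x + f y) \<and> (\<forall>c. \<forall>x\<in>V. f (s1 c x) = s2 c (f x))"

definition bilinear_on ::
  "'a set \<Rightarrow> ('k \<Rightarrow> 'a \<Rightarrow> 'a) \<Rightarrow> ('k \<Rightarrow> 'b \<Rightarrow> 'b) \<Rightarrow> ('a::plus \<Rightarrow> 'a \<Rightarrow> 'b::plus) \<Rightarrow> bool" where
  "bilinear_on V s1 s2 f \<longleftrightarrow>
     (\<forall>x\<in>V. linear_on V s1 s2 (f x)) \<and> (\<forall>y\<in>V. linear_on V s1 s2 (\<lambda>x. f x y))"

locale lie_superalgebra = vector_space "smul L"
  for L :: "('k::{alg_closed_field, field_char_0}, 'a::ab_group_add, 'm) superalg_scheme" +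
  assumes subspace_comp: "subspace (comp L p)"
    and comp_disjoint: "comp L 0 \<inter> comp L 1 = {0}"
    and finite_dim: "\<exists>B. finite B \<and> span B = carrier L"
    and bracket_bilinear: "bilinear_on (carrier L) (smul L) (smul L) (bracket L)"
    and bracket_degree: "x \<in> comp L p \<Longrightarrow> y \<in> comp L q \<Longrightarrow> bracket L x y \<in> comp L (p + q)"
    and bracket_skew: "x \<in> comp L p \<Longrightarrow> y \<in> comp L q \<Longrightarrow>
      bracket L x y = - smul L (sg (p * q)) (bracket L y x)"
    and jacobi: "x \<in> comp L p \<Longrightarrow> y \<in> comp L q \<Longrightarrow> z \<in> comp L r \<Longrightarrow>
      smul L (sg (r * p)) (bracket L x (bracket L y z))
      + smul L (sg (p * q)) (bracket L y (bracket L z x))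
      + smul L (sg (q * r)) (bracket L z (bracket L x y)) = 0"

primrec lower_central ::
  "('k::field, 'a::ab_group_add, 'm) superalg_scheme \<Rightarrow> nat \<Rightarrow> 'a set" where
  "lower_central L 0 = carrier L"
| "lower_central L (Suc n) =
     module.span (smul L) {bracket L x y |x y. x \<in> carrier L \<and> y \<in> lower_central L n}"

definition nilpotent :: "('k::field, 'a::ab_group_add, 'm) superalg_scheme \<Rightarrow> bool" where
  "nilpotent L \<longleftrightarrow> (\<exists>n. lower_central L n = {0})"

definition superderivation ::
  "('k::field, 'a::ab_group_add, 'm) superalg_scheme \<Rightarrow> bit \<Rightarrow> ('a \<Rightarrow> 'a) \<Rightarrow> bool" where
  "superderivation L d D \<longleftrightarrow>
     linear_on (carrier L) (smul L) (smul L) D \<and>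
     (\<forall>p. D ` comp L p \<subseteq> comp L (p + d)) \<and>
     (\<forall>p q. \<forall>x\<in>comp L p. \<forall>y\<in>comp L q.
        D (bracket L x y) = bracket L (D x) y + smul L (sg (d * p)) (bracket L x (D y)))"


section \<open>Even-symplectic Lie superalgebras\<close>

locale even_symplectic = lie_superalgebra S
  for S :: "('k::{alg_closed_field, field_char_0}, 'a::ab_group_add) symp_superalg" +
  assumes form_bilinear: "bilinear_on (carrier S) (smul S) (*) (form S)"
    and form_even: "x \<in> comp S p \<Longrightarrow> y \<in> comp S q \<Longrightarrow> p \<noteq> q \<Longrightarrow> form S x y = 0"
    and form_skew: "x \<in> comp S p \<Longrightarrow> y \<in> comp S q \<Longrightarrow> form S x y = - sg (p * q) * form S y x"
    and form_nondegenerate: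
      "x \<in> carrier S \<Longrightarrow> (\<And>y. y \<in> carrier S \<Longrightarrow> form S x y = 0) \<Longrightarrow> x = 0"
    and form_closed: "x \<in> comp S p \<Longrightarrow> y \<in> comp S q \<Longrightarrow> z \<in> comp S r \<Longrightarrow>
      sg (r * p) * form S x (bracket S y z)
      + sg (p * q) * form S y (bracket S z x)
      + sg (q * r) * form S z (bracket S x y) = 0"

definition symp_isomorphic ::
  "('k::field, 'a::ab_group_add) symp_superalg \<Rightarrow> ('k, 'b::ab_group_add) symp_superalg \<Rightarrow> bool" where
  "symp_isomorphic S T \<longleftrightarrow> (\<exists>\<phi>.
     bij_betw \<phi> (carrier S) (carrier T) \<and>
     linear_on (carrier S) (smul S) (smul T) \<phi> \<and>
     (\<forall>p. \<phi> ` comp S p = comp T p) \<and>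
     (\<forall>x\<in>carrier S. \<forall>y\<in>carrier S. \<phi> (bracket S x y) = bracket T (\<phi> x) (\<phi> y)) \<and>
     (\<forall>x\<in>carrier S. \<forall>y\<in>carrier S. form T (\<phi> x) (\<phi> y) = form S x y))"

text \<open>
  The adjoint \<open>D\<^sup>*\<close> on the underlying space; it is well defined because the form is non-degenerate
  and the space is finite dimensional.
\<close>

definition adjoint :: "('k::field, 'a::ab_group_add) symp_superalg \<Rightarrow> ('a \<Rightarrow> 'a) \<Rightarrow> 'a \<Rightarrow> 'a" where
  "adjoint H D x =
     (THE z. z \<in> carrier H \<and> (\<forall>y\<in>carrier H. form H z y = form H x (D y)))"


section \<open>Double extensions\<close>

definition hpart :: "('k::field, 'a::ab_group_add, 'm) superalg_scheme \<Rightarrow> bit \<Rightarrow> 'a \<Rightarrow> 'a" where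
  "hpart L p x = (THE y. y \<in> comp L p \<and> x - y \<in> comp L (p + 1))"

text \<open>
  The linear map given by \<open>x \<mapsto> (-1)\<^sup>d\<^sup>p x\<close> on elements of degree \<open>p\<close>. It serves to write
  formulas containing a sign \<open>(-1)\<^sup>d\<^sup>p\<close>, stated for homogeneous \<open>x\<close>, for arbitrary \<open>x\<close>.
\<close>

definition twist :: "('k::field, 'a::ab_group_add, 'm) superalg_scheme \<Rightarrow> bit \<Rightarrow> 'a \<Rightarrow> 'a" where
  "twist L d x = hpart L 0 x + smul L (sg d) (hpart L 1 x)"

definition ext_gamma ::
  "('k::field, 'a::ab_group_add) symp_superalg \<Rightarrow> bit \<Rightarrow> ('a \<Rightarrow> 'a) \<Rightarrow> 'a \<Rightarrow> 'a \<Rightarrow> 'k" where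
  "ext_gamma H d D x y = - sg d * (form H (D x) y + form H (twist H d x) (D y))"

text \<open>
  The space \<open>\<bbbK>e\<^sup>* \<oplus> \<hh> \<oplus> \<bbbK>e\<close> with \<open>e\<close>, \<open>e\<^sup>*\<close> of degree \<open>d\<close>, the triple \<open>(a, x, b)\<close> standing for
  \<open>a e\<^sup>* + x + b e\<close>. The bracket is the bilinear one with \<open>e\<^sup>*\<close> central, \<open>[e, e] = c\<close>,
  \<open>[e, y] = D y + f y e\<^sup>*\<close>, \<open>[x, e] = - (-1)\<^sup>d\<^sup>p [e, x]\<close> for \<open>x\<close> of degree \<open>p\<close>, and
  \<open>[x, y] = [x, y]\<^sub>\<hh> + \<gamma>(x, y) e\<^sup>*\<close>.
\<close>

definition extension ::
  "('k::field, 'a::ab_group_add) symp_superalg \<Rightarrow> bit \<Rightarrow> ('a \<Rightarrow> 'a) \<Rightarrow> 'a \<Rightarrow> ('a \<Rightarrow> 'k) \<Rightarrow>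
     ('k, 'k \<times> 'a \<times> 'k) symp_superalg" where
  "extension H d D c f = \<lparr>
     smul = (\<lambda>k (a, x, b). (k * a, smul H k x, k * b)),
     comp = (\<lambda>p. {(a, x, b). x \<in> comp H p \<and> (p \<noteq> d \<longrightarrow> a = 0 \<and> b = 0)}),
     bracket = (\<lambda>(a, x, b) (a', y, b').
       (b * f y - b' * f (twist H d x) + ext_gamma H d D x y,
        smul H (b * b') c + smul H b (D y) - smul H b' (D (twist H d x)) + bracket H x y,
        0)),
     form = (\<lambda>(a, x, b) (a', y, b'). a * b' - sg d * b * a' + form H x y)\<rparr>"

definition double_extension ::
  "('k::field, 'a::ab_group_add) symp_superalg \<Rightarrow> ('a \<Rightarrow> 'a) \<Rightarrow> 'a \<Rightarrow>
     ('k, 'k \<times> 'a \<times> 'k) symp_superalg" where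
  "double_extension H D b\<^sub>0 = extension H 0 D 0 (\<lambda>x. form H b\<^sub>0 x)"

definition double_extension_data ::
  "('k::field, 'a::ab_group_add) symp_superalg \<Rightarrow> ('a \<Rightarrow> 'a) \<Rightarrow> 'a \<Rightarrow> bool" where
  "double_extension_data H D b\<^sub>0 \<longleftrightarrow>
     superderivation H 0 D \<and> b\<^sub>0 \<in> comp H 0 \<and>
     (\<forall>x\<in>carrier H. \<forall>y\<in>carrier H.
        - form H (adjoint H D (D x + adjoint H D x) + (D (D x) + adjoint H D (D x))) y
        = form H b\<^sub>0 (bracket H x y))"

definition gen_double_extension ::
  "('k::field, 'a::ab_group_add) symp_superalg \<Rightarrow> ('a \<Rightarrow> 'a) \<Rightarrow> 'a \<Rightarrow>
     ('k, 'k \<times> 'a \<times> 'k) symp_superalg" where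
  "gen_double_extension H D x\<^sub>0 = extension H 1 D x\<^sub>0 (\<lambda>x. (1 / 2) * form H x\<^sub>0 x)"

definition gen_double_extension_data ::
  "('k::field, 'a::ab_group_add) symp_superalg \<Rightarrow> ('a \<Rightarrow> 'a) \<Rightarrow> 'a \<Rightarrow> bool" where
  "gen_double_extension_data H D x\<^sub>0 \<longleftrightarrow>
     superderivation H 1 D \<and> x\<^sub>0 \<in> comp H 0 \<and> D x\<^sub>0 = 0 \<and> form H x\<^sub>0 x\<^sub>0 = 0 \<and>
     (\<forall>x\<in>carrier H. D (D x) = smul H (1 / 2) (bracket H x\<^sub>0 x))"

text \<open>\<open>T\<close> is, up to isomorphism, a double extension or a generalized double extension of \<open>H\<close>.\<close>

definition extension_step ::
  "('k::{alg_closed_field, field_char_0}, 'a::ab_group_add) symp_superalg \<Rightarrow>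
     ('k, 'b::ab_group_add) symp_superalg \<Rightarrow> bool" where
  "extension_step H T \<longleftrightarrow> even_symplectic H \<and>
     ((\<exists>D b\<^sub>0. double_extension_data H D b\<^sub>0 \<and> symp_isomorphic T (double_extension H D b\<^sub>0)) \<or>
      (\<exists>D x\<^sub>0. gen_double_extension_data H D x\<^sub>0 \<and> symp_isomorphic T (gen_double_extension H D x\<^sub>0)))"

text \<open>
  Membership in \<open>\<UU>\<close>: the zero superalgebra, or a one-dimensional one with null even part.
\<close>

definition in_U ::
  "('k::{alg_closed_field, field_char_0}, 'a::ab_group_add, 'm) superalg_scheme \<Rightarrow> bool" where
  "in_U L \<longleftrightarrow> lie_superalgebra L \<and>
     (carrier L = {0} \<or> (comp L 0 = {0} \<and> vector_space.dim (smul L) (comp L 1) = 1))"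


section \<open>Consistency checks\<close>

context lie_superalgebra
begin

lemma hpart_unique:
  assumes "y \<in> comp L p" "x - y \<in> comp L (p + 1)"
  shows "hpart L p x = y"
  unfolding hpart_def
proof (rule the_equality)
  fix z assume z: "z \<in> comp L p \<and> x - z \<in> comp L (p + 1)"
  have "z - y \<in> comp L p"
    using z assms subspace_comp subspace_diff by blast
  moreover have "(x - y) - (x - z) \<in> comp L (p + 1)"
    using z assms subspace_comp subspace_diff by blast
  ultimately have "z - y \<in> comp L 0 \<inter> comp L 1"
    by (cases p) auto
  then show "z = y" using comp_disjoint by simp
qed (use assms in auto)

lemma twist_homogeneous:
  assumes "x \<in> comp L p"
  shows "twist L d x = smul L (sg (d * p)) x"
proof -
  have 1: "hpart L p x = x"
    by (rule hpart_unique) (use assms subspace_comp subspace_0 in auto)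
  have 2: "hpart L (p + 1) x = 0"
    by (rule hpart_unique) (use assms subspace_comp subspace_0 in auto)
  show ?thesis
    using 1 2 by (cases p) (auto simp: twist_def sg_def)
qed

end

context even_symplectic
begin

lemma zero_in_carrier: "0 \<in> carrier S"
  using subspace_0[OF subspace_comp] by (force simp: carrier_def)

lemma zero_args:
  assumes "x \<in> carrier S"
  shows "bracket S 0 x = 0" "bracket S x 0 = 0" "form S 0 x = 0" "form S x 0 = 0"
proof -
  have "bracket S (smul S 0 0) x = smul S 0 (bracket S 0 x)"
       "bracket S x (smul S 0 0) = smul S 0 (bracket S x 0)"
       "form S (smul S 0 0) x = 0 * form S 0 x" "form S x (smul S 0 0) = 0 * form S x 0"
    using bracket_bilinear form_bilinear assms zero_in_carrier
    unfolding bilinear_on_def linear_on_def by blast+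
  then show "bracket S 0 x = 0" "bracket S x 0 = 0" "form S 0 x = 0" "form S x 0 = 0"
    by simp_all
qed

lemma comp_in_carrier:
  assumes "x \<in> comp S p"
  shows "x \<in> carrier S"
proof -
  have "0 \<in> comp S 0" "0 \<in> comp S 1"
    using subspace_0[OF subspace_comp] by auto
  then show ?thesis
    using assms unfolding carrier_def
    by (cases p) (force intro: exI[of _ x] exI[of _ 0])+
qed

lemma derivation_zero: "superderivation S d D \<Longrightarrow> D 0 = 0"
  using zero_in_carrier unfolding superderivation_def linear_on_def
  by (metis scale_zero_left)

lemma twist_zero: "twist S d 0 = 0"
  using twist_homogeneous[OF subspace_0[OF subspace_comp]] by simp

lemma superderivation_in_carrier:
  assumes "superderivation S d D" "y \<in> comp S q" shows "D y \<in> carrier S"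
  using assms comp_in_carrier unfolding superderivation_def by blast

lemma extension_bracket:
  fixes D :: "'a \<Rightarrow> 'a" and f :: "'a \<Rightarrow> 'k" and c :: 'a and a b :: 'k
  assumes D: "superderivation S d D" and f: "f 0 = 0"
    and x: "x \<in> comp S p" and y: "y \<in> comp S q"
  defines "T \<equiv> extension S d D c f"
  shows "bracket T (0, 0, 1) (0, 0, 1) = (0, c, 0)"
    and "bracket T (0, 0, 1) (0, y, 0) = (f y, D y, 0)"
    and "bracket T (0, x, 0) (0, y, 0) =
      (- sg d * (form S (D x) y + sg (d * p) * form S x (D y)), bracket S x y, 0)"
    and "bracket T (1, 0, 0) (a, y, b) = 0"
proof -
  have car: "x \<in> carrier S" "y \<in> carrier S" "D x \<in> carrier S" "D y \<in> carrier S"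
    using x y D comp_in_carrier superderivation_in_carrier by blast+
  have s: "form S (smul S k x) z = k * form S x z" if "z \<in> carrier S" for k z
    using that car form_bilinear unfolding bilinear_on_def linear_on_def by simp
  note simps = T_def extension_def ext_gamma_def twist_zero derivation_zero[OF D] f
    zero_args car zero_in_carrier zero_prod_def
  show "bracket T (0, 0, 1) (0, 0, 1) = (0, c, 0)"
    and "bracket T (0, 0, 1) (0, y, 0) = (f y, D y, 0)"
    and "bracket T (1, 0, 0) (a, y, b) = 0"
    by (simp_all add: simps)
  show "bracket T (0, x, 0) (0, y, 0) =
      (- sg d * (form S (D x) y + sg (d * p) * form S x (D y)), bracket S x y, 0)"
    by (simp add: simps twist_homogeneous[OF x] s)
qed

end

end

theory Submission
  imports Defs
begin

text \<open>
  The proof is symplectic reduction by a central isotropic line, iterated by induction on the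
  dimension. Let \<open>es\<close> be a nonzero homogeneous central element with \<open>\<omega>(es, es) = 0\<close>. Closedness of
  \<open>\<omega>\<close> makes \<open>\<omega>(es, \<cdot>)\<close> vanish on all brackets, so the orthogonal \<open>es\<^sup>\<bottom>\<close> contains the derived
  algebra and the quotient \<open>es\<^sup>\<bottom> / \<langle>es\<rangle>\<close> is again a nilpotent even-symplectic Lie superalgebra, of
  smaller dimension. Completing \<open>es\<close> to a hyperbolic pair \<open>(es, e)\<close> realises this quotient inside the
  given space, as the orthogonal \<open>reduced\<close> of \<open>es\<close> and \<open>e\<close> with the bracket followed by the
  projection along \<open>es\<close> and \<open>e\<close>.

  The original superalgebra is an extension of its reduction (\<open>extension_step_reduced\<close>). In the
  coordinates \<open>a es + h + b e\<close>, closedness of \<open>\<omega>\<close> determines the \<open>es\<close>-component of \<open>[h, h']\<close>: it is the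
  cocycle \<open>\<gamma>\<close> of the projected derivation \<open>[e, \<cdot>]\<close>. If \<open>e\<close> is even, then \<open>[e, e] = 0\<close>, the
  \<open>es\<close>-component of \<open>[e, h]\<close> is a functional that non-degeneracy represents by some even \<open>b\<^sub>0\<close>, and
  the condition on \<open>b\<^sub>0\<close> is the derivation rule for \<open>[e, [h, h']]\<close> paired with \<open>e\<close>. If \<open>e\<close> is odd,
  then \<open>x\<^sub>0 = [e, e]\<close> is isotropic because it is even, and the other two conditions on it are instances
  of the Jacobi identity.

  It remains to see that an element \<open>es\<close> exists outside of \<open>\<UU>\<close> (\<open>in_U_of_anisotropic_center\<close>). In a
  nilpotent superalgebra every nonzero graded ideal contains a nonzero homogeneous central element
  (\<open>nilpotent_ideal_meets_center\<close>). Even elements are isotropic, so let \<open>z\<close> be an odd central element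
  with \<open>\<omega>(z, z) \<noteq> 0\<close>. Its orthogonal is an ideal. If this ideal is nonzero, then it contains a
  second central element \<open>w\<close>, and as the field is algebraically closed some combination \<open>z + t w\<close> is
  isotropic. Otherwise the whole superalgebra is the odd line through \<open>z\<close>.
\<close>

section \<open>Calculus in a Lie superalgebra\<close>

lemma sg_mult_self: "sg p * sg p = (1 :: 'k::field)"
  by (cases p) (simp_all add: sg_def)

context lie_superalgebra
begin

lemma comp_subset_carrier: "comp L p \<subseteq> carrier L"
proof
  fix x assume "x \<in> comp L p"
  moreover have "0 \<in> comp L 0" "0 \<in> comp L 1"
    using subspace_0[OF subspace_comp] by auto
  ultimately show "x \<in> carrier L"
    unfolding carrier_def by (cases p) (force intro: exI[of _ x] exI[of _ 0])+
qed

lemma subspace_carrier: "subspace (carrier L)"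
proof -
  have "carrier L = {x + y |x y. x \<in> comp L 0 \<and> y \<in> comp L 1}"
    by (simp add: carrier_def)
  then show ?thesis
    using subspace_sums[OF subspace_comp subspace_comp, of 0 1] by simp
qed

lemmas carrier_0 = subspace_0[OF subspace_carrier]
  and carrier_add = subspace_add[OF subspace_carrier]
  and carrier_diff = subspace_diff[OF subspace_carrier]
  and carrier_neg = subspace_neg[OF subspace_carrier]
  and carrier_scale = subspace_scale[OF subspace_carrier]
  and carrier_comp = subsetD[OF comp_subset_carrier]

lemmas comp_0 = subspace_0[OF subspace_comp]
  and comp_add = subspace_add[OF subspace_comp]
  and comp_diff = subspace_diff[OF subspace_comp]
  and comp_neg = subspace_neg[OF subspace_comp]
  and comp_scale = subspace_scale[OF subspace_comp]

lemma carrier_decompose: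
  assumes "x \<in> carrier L"
  obtains u v where "u \<in> comp L p" "v \<in> comp L (p + 1)" "x = u + v"
proof -
  obtain u v where "u \<in> comp L 0" "v \<in> comp L 1" "x = u + v"
    using assms unfolding carrier_def by blast
  then show thesis
    by (cases p) (auto intro: that simp: add.commute)
qed

lemma carrier_induct [consumes 1, case_names homogeneous add]:
  assumes "x \<in> carrier L"
    and "\<And>p u. u \<in> comp L p \<Longrightarrow> P u"
    and "\<And>u v. u \<in> carrier L \<Longrightarrow> v \<in> carrier L \<Longrightarrow> P u \<Longrightarrow> P v \<Longrightarrow> P (u + v)"
  shows "P x"
  using assms carrier_decompose[OF assms(1), of 0] carrier_comp by metis

lemma comp_unique:
  assumes "u \<in> comp L p" "v \<in> comp L (p + 1)" "u + v = 0"
  shows "u = 0" "v = 0"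
proof -
  have "u = - v" using assms(3) by (simp add: eq_neg_iff_add_eq_0)
  then have "u \<in> comp L (p + 1)" using assms(2) comp_neg by blast
  then have "u \<in> comp L 0 \<inter> comp L 1" using assms(1) by (cases p) auto
  then show "u = 0" "v = 0" using comp_disjoint assms(3) by auto
qed

lemma eq_neg_self: "x = - x \<Longrightarrow> x = (0::'a)"
proof -
  assume "x = - x"
  then have "smul L 2 x = 0"
    using scale_left_distrib[of 1 1 x] by (simp add: eq_neg_iff_add_eq_0)
  then show ?thesis by simp
qed

lemma bracket_add_left: "x \<in> carrier L \<Longrightarrow> y \<in> carrier L \<Longrightarrow> z \<in> carrier L \<Longrightarrow>
    bracket L (x + y) z = bracket L x z + bracket L y z"
  and bracket_add_right: "x \<in> carrier L \<Longrightarrow> y \<in> carrier L \<Longrightarrow> z \<in> carrier L \<Longrightarrow>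
    bracket L z (x + y) = bracket L z x + bracket L z y"
  and bracket_scale_left: "x \<in> carrier L \<Longrightarrow> z \<in> carrier L \<Longrightarrow>
    bracket L (smul L c x) z = smul L c (bracket L x z)"
  and bracket_scale_right: "x \<in> carrier L \<Longrightarrow> z \<in> carrier L \<Longrightarrow>
    bracket L z (smul L c x) = smul L c (bracket L z x)"
  using bracket_bilinear unfolding bilinear_on_def linear_on_def by blast+

lemma bracket_neg_right: "x \<in> carrier L \<Longrightarrow> z \<in> carrier L \<Longrightarrow>
    bracket L z (- x) = - bracket L z x"
  using bracket_scale_right[of x z "-1"] by simp

lemma bracket_carrier:
  assumes x: "x \<in> carrier L" and y: "y \<in> carrier L"
  shows "bracket L x y \<in> carrier L"
  using x
proof (induction rule: carrier_induct)
  case (homogeneous p u)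
  show ?case
    using y
  proof (induction rule: carrier_induct)
    case (homogeneous q v)
    then show ?case
      using \<open>u \<in> comp L p\<close> bracket_degree carrier_comp by blast
  next
    case (add v w)
    then show ?case
      using \<open>u \<in> comp L p\<close> carrier_comp by (auto simp: bracket_add_right intro: carrier_add)
  qed
next
  case (add u v)
  then show ?case by (simp add: bracket_add_left y carrier_add)
qed

lemma bracket_even_self: "x \<in> comp L 0 \<Longrightarrow> bracket L x x = 0"
  using bracket_skew[of x 0 x 0] eq_neg_self by (simp add: sg_def)

text \<open>The Jacobi identity with all signs moved to where the derivation rule for \<open>[x, \<cdot>]\<close> has them.\<close>

lemma bracket_leibniz:
  assumes x: "x \<in> comp L p" and y: "y \<in> comp L q" and z: "z \<in> carrier L"
  shows "bracket L x (bracket L y z) =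
    bracket L (bracket L x y) z + smul L (sg (p * q)) (bracket L y (bracket L x z))"
  using z
proof (induction rule: carrier_induct)
  case (homogeneous r z)
  note car = bracket_carrier carrier_comp[OF x] carrier_comp[OF y] carrier_comp[OF homogeneous]
  have 1: "bracket L z x = - smul L (sg (r * p)) (bracket L x z)"
    by (rule bracket_skew[OF homogeneous x])
  have 2: "bracket L z (bracket L x y) = - smul L (sg (r * (p + q))) (bracket L (bracket L x y) z)"
    by (rule bracket_skew[OF homogeneous bracket_degree[OF x y]])
  have "bracket L y (bracket L z x) = - smul L (sg (r * p)) (bracket L y (bracket L x z))"
    unfolding 1 by (simp add: bracket_neg_right bracket_scale_right car carrier_scale)
  with 2 jacobi[OF x y homogeneous] show ?case
    by (cases p; cases q; cases r) (auto simp: sg_def algebra_simps eq_neg_iff_add_eq_0 neg_eq_iff_add_eq_0)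
next
  case (add u v)
  note car = bracket_carrier carrier_comp[OF x] carrier_comp[OF y] add(1,2)
  show ?case
    using add(3,4) by (simp add: bracket_add_right car scale_right_distrib algebra_simps)
qed

lemma twist_decomposed:
  assumes "u \<in> comp L 0" "v \<in> comp L 1"
  shows "twist L d (u + v) = u + smul L (sg d) v"
proof -
  have "hpart L 0 (u + v) = u" "hpart L 1 (u + v) = v"
    by (rule hpart_unique; use assms in simp)+
  then show ?thesis by (simp add: twist_def)
qed

lemma twist_zero_degree:
  assumes "x \<in> carrier L"
  shows "twist L 0 x = x"
proof -
  obtain u v where "u \<in> comp L 0" "v \<in> comp L 1" "x = u + v"
    using assms unfolding carrier_def by blast
  then show ?thesis by (simp add: twist_decomposed sg_def)
qed

text \<open>
  Writing the sign with \<^const>\<open>twist\<close> makes both sides linear in \<open>y\<close>, so that \<open>y\<close> need not be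
  homogeneous.
\<close>

lemma bracket_leibniz_twist:
  assumes x: "x \<in> comp L p" and y: "y \<in> carrier L" and z: "z \<in> carrier L"
  shows "bracket L x (bracket L y z) =
    bracket L (bracket L x y) z + bracket L (twist L p y) (bracket L x z)"
proof -
  obtain u v where uv: "u \<in> comp L 0" "v \<in> comp L 1" "y = u + v"
    using y unfolding carrier_def by blast
  note car = carrier_comp[OF x] carrier_comp[OF uv(1)] carrier_comp[OF uv(2)] z bracket_carrier
  show ?thesis
    using bracket_leibniz[OF x uv(1) z] bracket_leibniz[OF x uv(2) z]
    by (simp add: uv(3) twist_decomposed[OF uv(1,2)] bracket_add_left bracket_add_right car
        carrier_scale bracket_scale_left sg_def algebra_simps)
qed

lemma twist_carrier:
  assumes "x \<in> carrier L"
  shows "twist L d x \<in> carrier L"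
proof -
  obtain u v where "u \<in> comp L 0" "v \<in> comp L 1" "x = u + v"
    using assms unfolding carrier_def by blast
  then show ?thesis
    by (simp add: twist_decomposed carrier_add carrier_scale carrier_comp)
qed

lemma bracket_swap:
  assumes e: "e \<in> comp L d" and x: "x \<in> carrier L"
  shows "bracket L x e = - bracket L e (twist L d x)"
proof -
  obtain u v where uv: "u \<in> comp L 0" "v \<in> comp L 1" "x = u + v"
    using x unfolding carrier_def by blast
  note car = carrier_comp[OF e] carrier_comp[OF uv(1)] carrier_comp[OF uv(2)]
  show ?thesis
    using bracket_skew[OF uv(1) e] bracket_skew[OF uv(2) e]
    by (simp add: uv(3) twist_decomposed[OF uv(1,2)] bracket_add_left bracket_add_right car
        carrier_scale bracket_scale_right sg_def)
qed

section \<open>Central elements of nilpotent Lie superalgebras\<close>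

text \<open>
  Consider the last term of the lower central series that meets \<open>J\<close> nontrivially. An element of this
  intersection is bracketed into the intersection of \<open>J\<close> with the next term, hence to zero. Both
  homogeneous parts of a central element are central, because their brackets with a homogeneous
  element have different degrees and cannot cancel.
\<close>

lemma nilpotent_ideal_meets_center:
  assumes "nilpotent L" and J: "subspace J" "J \<subseteq> carrier L" "J \<noteq> {0}"
    and ideal: "\<And>x y. x \<in> carrier L \<Longrightarrow> y \<in> J \<Longrightarrow> bracket L x y \<in> J"
    and graded: "\<And>u v. u \<in> comp L 0 \<Longrightarrow> v \<in> comp L 1 \<Longrightarrow> u + v \<in> J \<Longrightarrow> u \<in> J"
  shows "\<exists>p z. z \<in> comp L p \<and> z \<in> J \<and> z \<noteq> 0 \<and> (\<forall>x\<in>carrier L. bracket L x z = 0)"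
proof -
  have J0: "0 \<in> J" using J(1) by (rule subspace_0)
  obtain N where "lower_central L N = {0}"
    using assms(1) unfolding nilpotent_def by blast
  then have ex: "\<exists>n. J \<inter> lower_central L n = {0}" using J0 by blast
  define n where "n = (LEAST n. J \<inter> lower_central L n = {0})"
  have n: "J \<inter> lower_central L n = {0}"
    unfolding n_def by (rule LeastI_ex[OF ex])
  have "n \<noteq> 0" using n J(2,3) by (metis inf.absorb1 lower_central.simps(1))
  then obtain m where m: "n = Suc m" by (cases n) auto
  have "J \<inter> lower_central L m \<noteq> {0}"
    using not_less_Least[of m "\<lambda>n. J \<inter> lower_central L n = {0}"] m unfolding n_def by simp
  moreover have "0 \<in> lower_central L m"
    by (cases m) (auto simp: carrier_0 span_zero)
  ultimately obtain z where z: "z \<in> J" "z \<in> lower_central L m" "z \<noteq> 0" using J0 by blast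
  have central: "bracket L x z = 0" if "x \<in> carrier L" for x
  proof -
    have "bracket L x z \<in> lower_central L n"
      using that z(2) by (auto simp: m intro!: span_base)
    then show ?thesis using ideal[OF that z(1)] n by blast
  qed
  obtain u v where uv: "u \<in> comp L 0" "v \<in> comp L 1" "z = u + v"
    using z(1) J(2) unfolding carrier_def by blast
  have homog: "bracket L x u = 0 \<and> bracket L x v = 0" if "x \<in> carrier L" for x
    using that
  proof (induction rule: carrier_induct)
    case (homogeneous q x)
    have "bracket L x u + bracket L x v = 0"
      using central[of x] homogeneous uv carrier_comp by (simp add: bracket_add_right)
    moreover have "bracket L x u \<in> comp L q" "bracket L x v \<in> comp L (q + 1)"
      using bracket_degree[OF homogeneous uv(1)] bracket_degree[OF homogeneous uv(2)]
      by (simp_all only: add_0_right)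
    ultimately show ?case using comp_unique by blast
  next
    case (add x y)
    then show ?case using uv carrier_comp by (simp add: bracket_add_left)
  qed
  have uJ: "u \<in> J" using graded uv z(1) by blast
  have vJ: "v \<in> J" using subspace_diff[OF J(1) z(1) uJ] uv(3) by simp
  show ?thesis
  proof (cases "u = 0")
    case True
    then have "v \<noteq> 0" using uv(3) z(3) by simp
    then show ?thesis using uv(2) vJ homog by blast
  next
    case False
    then show ?thesis using uv(1) uJ homog by blast
  qed
qed

end

section \<open>Non-degenerate forms on finite-dimensional spaces\<close>

text \<open>
  By induction on \<open>A\<close>: it suffices to find \<open>k\<close> with \<open>\<beta>(k, \<cdot>)\<close> zero on the old vectors and nonzero at the
  new vector \<open>a\<close>, since a multiple of \<open>k\<close> then corrects the value at \<open>a\<close>. If there were none, the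
  functional \<open>\<beta>(\<cdot>, a)\<close> would be a linear combination of the functionals \<open>\<beta>(\<cdot>, b)\<close> with \<open>b\<close> old, and
  non-degeneracy would turn this into a linear dependence of \<open>a\<close> on the old vectors.
\<close>

lemma (in vector_space) nondegenerate_interpolation:
  assumes V: "subspace V" and B: "bilinear_on V scale (*) \<beta>"
    and nondeg: "\<And>y. y \<in> V \<Longrightarrow> (\<And>x. x \<in> V \<Longrightarrow> \<beta> x y = 0) \<Longrightarrow> y = 0"
    and A: "finite A" "independent A" "A \<subseteq> V"
  shows "\<exists>z\<in>V. \<forall>a\<in>A. \<beta> z a = g a"
  using A
proof (induction A arbitrary: g rule: finite_induct)
  case empty
  then show ?case using subspace_0[OF V] by auto
next
  case (insert a A)
  have ind: "independent A" "a \<notin> span A"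
    using insert.prems(1) insert.hyps(2) by (auto simp: independent_insert)
  have AV: "A \<subseteq> V" "a \<in> V" using insert.prems(2) by auto
  have l: "\<beta> (x + y) z = \<beta> x z + \<beta> y z" "\<beta> z (x + y) = \<beta> z x + \<beta> z y"
    if "x \<in> V" "y \<in> V" "z \<in> V" for x y z
    using that B unfolding bilinear_on_def linear_on_def by blast+
  have s: "\<beta> (scale c x) z = c * \<beta> x z" "\<beta> z (scale c x) = c * \<beta> z x"
    if "x \<in> V" "z \<in> V" for c x z
    using that B unfolding bilinear_on_def linear_on_def by blast+
  have sum_in: "(\<Sum>i\<in>I. scale (c i) (h i)) \<in> V" if "h ` I \<subseteq> V" for I :: "'b set" and c h
    using that by (intro subspace_sum[OF V] subspace_scale[OF V]) auto
  have z0: "\<beta> 0 z = 0" "\<beta> z 0 = 0" if "z \<in> V" for z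
    using s[of 0 z 0] that subspace_0[OF V] by auto
  have suml: "\<beta> (\<Sum>i\<in>I. scale (c i) (h i)) z = (\<Sum>i\<in>I. c i * \<beta> (h i) z)"
       "\<beta> z (\<Sum>i\<in>I. scale (c i) (h i)) = (\<Sum>i\<in>I. c i * \<beta> z (h i))"
    if "finite I" "h ` I \<subseteq> V" "z \<in> V" for I :: "'b set" and c h z
    using that(1,2)
    by (induction I rule: finite_induct) (simp_all add: z0 l s that(3) sum_in subspace_scale[OF V])
  have IH: "\<exists>z\<in>V. \<forall>a\<in>A. \<beta> z a = g a" for g
    using insert.IH[OF ind(1) AV(1)] .
  have "\<exists>z\<in>V. (\<forall>b\<in>A. \<beta> z b = 0) \<and> \<beta> z a \<noteq> 0"
  proof (rule ccontr)
    assume "\<not> ?thesis"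
    then have contra: "\<beta> z a = 0" if "z \<in> V" "\<And>b. b \<in> A \<Longrightarrow> \<beta> z b = 0" for z
      using that by blast
    have "\<forall>b. \<exists>z. z \<in> V \<and> (\<forall>c\<in>A. \<beta> z c = (if c = b then 1 else 0))"
    proof
      fix b
      show "\<exists>z. z \<in> V \<and> (\<forall>c\<in>A. \<beta> z c = (if c = b then 1 else 0))"
        using IH[of "\<lambda>c. if c = b then 1 else 0"] by blast
    qed
    then have "\<exists>h. \<forall>b. h b \<in> V \<and> (\<forall>c\<in>A. \<beta> (h b) c = (if c = b then 1 else 0))"
      by (rule choice)
    \<comment> \<open>On the old vectors, \<open>h\<close> is the dual system; it expresses \<open>\<beta>(\<cdot>, a)\<close> as \<open>\<beta>(\<cdot>, w)\<close> below.\<close>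
    then obtain h where h: "\<And>b. h b \<in> V"
      "\<And>b c. c \<in> A \<Longrightarrow> \<beta> (h b) c = (if c = b then 1 else 0)"
      by blast
    have hV: "h ` A \<subseteq> V" using h(1) by auto
    define w where "w = (\<Sum>b\<in>A. scale (\<beta> (h b) a) b)"
    have wV: "w \<in> V" unfolding w_def using sum_in[of "\<lambda>b. b" A] AV by simp
    have eq: "\<beta> z a = \<beta> z w" if z: "z \<in> V" for z
    proof -
      define s where "s = (\<Sum>b\<in>A. scale (\<beta> z b) (h b))"
      have sV: "s \<in> V" unfolding s_def using sum_in hV by blast
      have sc: "\<beta> s c = \<beta> z c" if "c \<in> A" for c
      proof -
        have "\<beta> s c = (\<Sum>b\<in>A. \<beta> z b * \<beta> (h b) c)"
          unfolding s_def using suml(1)[OF insert.hyps(1) hV] that AV by blast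
        also have "\<dots> = (\<Sum>b\<in>A. if c = b then \<beta> z b else 0)"
          by (intro sum.cong) (auto simp: h(2)[OF that])
        also have "\<dots> = \<beta> z c" using insert.hyps(1) that by simp
        finally show ?thesis .
      qed
      have d: "\<beta> (z + scale (-1) s) y = \<beta> z y - \<beta> s y" if "y \<in> V" for y
        using that z sV by (simp only: l(1) s(1) subspace_scale[OF V]) simp
      have "\<beta> (z + scale (-1) s) a = 0"
        using contra[of "z + scale (-1) s"] sc d z sV AV subspace_add[OF V] subspace_scale[OF V]
        by (metis cancel_comm_monoid_add_class.diff_cancel subsetD)
      then have "\<beta> z a = \<beta> s a" using d AV by simp
      also have "\<dots> = (\<Sum>b\<in>A. \<beta> z b * \<beta> (h b) a)"
        unfolding s_def using suml(1)[OF insert.hyps(1) hV] AV by blast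
      also have "\<dots> = \<beta> z w"
        unfolding w_def using suml(2)[OF insert.hyps(1), of "\<lambda>b. b" z] AV z
        by (simp add: mult.commute)
      finally show ?thesis .
    qed
    have "\<beta> z (a + scale (-1) w) = 0" if "z \<in> V" for z
      using that wV AV eq by (simp only: l(2) s(2) subspace_scale[OF V]) simp
    then have "a + scale (-1) w = 0"
      using nondeg AV wV subspace_add[OF V] subspace_scale[OF V] by blast
    then have "a = w" by simp
    moreover have "w \<in> span A" unfolding w_def by (intro span_sum span_scale span_base)
    ultimately show False using ind(2) by blast
  qed
  then obtain k where k: "k \<in> V" "\<And>b. b \<in> A \<Longrightarrow> \<beta> k b = 0" "\<beta> k a \<noteq> 0" by blast
  obtain z where z: "z \<in> V" "\<And>b. b \<in> A \<Longrightarrow> \<beta> z b = g b" using IH by blast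
  let ?z = "z + scale ((g a - \<beta> z a) / \<beta> k a) k"
  have "\<beta> ?z y = \<beta> z y + (g a - \<beta> z a) / \<beta> k a * \<beta> k y" if "y \<in> V" for y
    using that z(1) k(1) by (simp only: l(1) s(1) subspace_scale[OF V])
  then have "\<forall>b\<in>insert a A. \<beta> ?z b = g b"
    using AV z(2) k(2,3) by auto
  then show ?case using subspace_add[OF V z(1) subspace_scale[OF V k(1)]] by blast
qed

text \<open>
  The ambient space may have infinite dimension, so finiteness enters through the spanning set \<open>C\<close>.
\<close>

lemma (in vector_space) dim_psubset_subspace:
  assumes V: "subspace V" and W: "V \<subset> W" and C: "finite C" "W \<subseteq> span C"
  shows "dim V < dim W"
proof -
  obtain B where B: "B \<subseteq> V" "independent B" "V \<subseteq> span B" "card B = dim V"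
    using basis_exists by blast
  obtain E where E: "E \<subseteq> W" "independent E" "W \<subseteq> span E" "card E = dim W"
    using basis_exists by blast
  have finE: "finite E" using independent_span_bound[OF C(1) E(2)] E(1) C(2) by blast
  obtain a where a: "a \<in> W" "a \<notin> V" using W by blast
  have "span B = V" using B V span_minimal by blast
  then have ind: "independent (insert a B)" "a \<notin> B"
    using a B(2) span_superset by (auto simp: independent_insert)
  have "insert a B \<subseteq> span E" using a B(1) W E(3) by blast
  then have "finite (insert a B) \<and> card (insert a B) \<le> card E"
    by (rule independent_span_bound[OF finE ind(1)])
  then have "card B < card E" using ind(2) by (auto simp: card_insert_disjoint)
  then show ?thesis using B(4) E(4) by simp
qed

section \<open>Even-symplectic forms and adjoints\<close>

context even_symplectic
begin

lemma form_add_left: "x \<in> carrier S \<Longrightarrow> y \<in> carrier S \<Longrightarrow> z \<in> carrier S \<Longrightarrow>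
    form S (x + y) z = form S x z + form S y z"
  and form_add_right: "x \<in> carrier S \<Longrightarrow> y \<in> carrier S \<Longrightarrow> z \<in> carrier S \<Longrightarrow>
    form S z (x + y) = form S z x + form S z y"
  and form_scale_left: "x \<in> carrier S \<Longrightarrow> z \<in> carrier S \<Longrightarrow>
    form S (smul S c x) z = c * form S x z"
  and form_scale_right: "x \<in> carrier S \<Longrightarrow> z \<in> carrier S \<Longrightarrow>
    form S z (smul S c x) = c * form S z x"
  using form_bilinear unfolding bilinear_on_def linear_on_def by blast+

lemma form_neg_left: "x \<in> carrier S \<Longrightarrow> z \<in> carrier S \<Longrightarrow> form S (- x) z = - form S x z"
  and form_neg_right: "x \<in> carrier S \<Longrightarrow> z \<in> carrier S \<Longrightarrow> form S z (- x) = - form S z x"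
  using form_scale_left[of x z "-1"] form_scale_right[of x z "-1"] by simp_all

lemma form_diff_left: "x \<in> carrier S \<Longrightarrow> y \<in> carrier S \<Longrightarrow> z \<in> carrier S \<Longrightarrow>
    form S (x - y) z = form S x z - form S y z"
  and form_diff_right: "x \<in> carrier S \<Longrightarrow> y \<in> carrier S \<Longrightarrow> z \<in> carrier S \<Longrightarrow>
    form S z (x - y) = form S z x - form S z y"
  using form_add_left[of x "- y" z] form_add_right[of x "- y" z]
  by (simp_all add: form_neg_left form_neg_right carrier_neg)

lemma form_swap:
  assumes e: "e \<in> comp S d" and x: "x \<in> carrier S"
  shows "form S x e = - sg d * form S e x"
  using x
proof (induction rule: carrier_induct)
  case (homogeneous p x)
  show ?case
  proof (cases "p = d")
    case True
    then show ?thesis using form_skew[OF homogeneous e] by simp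
  next
    case False
    then show ?thesis using form_even[OF homogeneous e] form_even[OF e homogeneous] by simp
  qed
next
  case (add u v)
  then show ?case
    by (simp add: form_add_left form_add_right carrier_comp[OF e] algebra_simps)
qed

lemma form_even_self:
  assumes "x \<in> comp S 0"
  shows "form S x x = 0"
proof -
  have "form S x x = - form S x x"
    using form_skew[OF assms assms] by (simp add: sg_def)
  then show ?thesis by (simp add: eq_neg_iff_add_eq_0)
qed

lemma form_nondegenerate_right:
  assumes y: "y \<in> carrier S" and z: "\<And>x. x \<in> carrier S \<Longrightarrow> form S x y = 0"
  shows "y = 0"
proof (rule form_nondegenerate[OF y])
  fix x assume "x \<in> carrier S"
  then show "form S y x = 0"
  proof (induction rule: carrier_induct)
    case (homogeneous p x)
    then show ?case using form_swap[OF homogeneous y] z carrier_comp by simp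
  next
    case (add u v)
    then show ?case by (simp add: form_add_right y)
  qed
qed

text \<open>
  Closedness of the form, solved for the term with \<open>e\<close> outside of the bracket. For central \<open>e\<close> it shows
  that \<open>e\<close> is orthogonal to all brackets; for the other half of a hyperbolic pair it computes the
  cocycle of the extension.
\<close>

lemma form_bracket:
  assumes e: "e \<in> comp S d" and x: "x \<in> carrier S" and y: "y \<in> carrier S"
  shows "form S e (bracket S x y) =
    form S (bracket S e x) y + form S (twist S d x) (bracket S e y)"
proof -
  have hom: "form S e (bracket S x y) =
      form S (bracket S e x) y + sg (d * p) * form S x (bracket S e y)"
    if x: "x \<in> comp S p" for x p
    using y
  proof (induction rule: carrier_induct)
    case (homogeneous r y)
    note car = carrier_comp[OF e] carrier_comp[OF x] carrier_comp[OF homogeneous]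
    have 1: "form S x (bracket S y e) = - sg (r * d) * form S x (bracket S e y)"
      using bracket_skew[OF homogeneous e]
      by (simp add: form_neg_right form_scale_right carrier_scale bracket_carrier car)
    have 2: "form S y (bracket S e x) = - sg (r * (d + p)) * form S (bracket S e x) y"
    proof (cases "r = d + p")
      case True
      then show ?thesis using form_skew[OF homogeneous bracket_degree[OF e x]] by simp
    next
      case False
      then show ?thesis
        using form_even[OF homogeneous bracket_degree[OF e x]]
          form_even[OF bracket_degree[OF e x] homogeneous] by simp
    qed
    show ?case
      using form_closed[OF e x homogeneous] 1 2
      by (cases p; cases d; cases r) (auto simp: sg_def algebra_simps add_eq_0_iff)
  next
    case (add u v)
    then show ?case
      by (simp add: form_add_right bracket_add_right bracket_carrier carrier_comp[OF e]
          carrier_comp[OF x] algebra_simps)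
  qed
  obtain u v where uv: "u \<in> comp S 0" "v \<in> comp S 1" "x = u + v"
    using x unfolding carrier_def by blast
  note car = carrier_comp[OF e] carrier_comp[OF uv(1)] carrier_comp[OF uv(2)] y
  show ?thesis
    using hom[OF uv(1)] hom[OF uv(2)]
    by (simp add: uv(3) twist_decomposed[OF uv(1,2)] bracket_add_left bracket_add_right car
        form_add_left form_add_right form_scale_left carrier_scale bracket_carrier sg_def)
qed

text \<open>
  Two functionals that agree on a basis are equal, and the values on a basis can be prescribed by
  \<open>nondegenerate_interpolation\<close>.
\<close>

lemma functional_representation:
  assumes g: "linear_on (carrier S) (smul S) (*) g"
  obtains z where "z \<in> carrier S" "\<And>y. y \<in> carrier S \<Longrightarrow> form S z y = g y"
proof -
  obtain C where C: "finite C" "span C = carrier S" using finite_dim by blast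
  obtain B where B: "B \<subseteq> carrier S" "independent B" "carrier S \<subseteq> span B"
    by (rule basis_exists)
  have fin: "finite B" using independent_span_bound[OF C(1) B(2)] B(1) C(2) by simp
  have "\<exists>z\<in>carrier S. \<forall>b\<in>B. form S z b = g b"
    by (rule nondegenerate_interpolation[OF subspace_carrier form_bilinear form_nondegenerate_right
          fin B(2,1)])
  then obtain z where z: "z \<in> carrier S" "\<And>b. b \<in> B \<Longrightarrow> form S z b = g b" by auto
  have "g (smul S 0 0) = 0 * g 0"
    using g carrier_0 unfolding linear_on_def by blast
  then have "g 0 = 0" by simp
  moreover have "g (u + v) = g u + g v" "g (smul S c u) = c * g u"
    if "u \<in> carrier S" "v \<in> carrier S" for c u v
    using g that unfolding linear_on_def by blast+
  ultimately have "subspace {y \<in> carrier S. form S z y = g y}"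
    using z(1)
    by (intro subspaceI)
      (simp_all add: carrier_0 zero_args form_add_right form_scale_right carrier_add carrier_scale)
  then have "span B \<subseteq> {y \<in> carrier S. form S z y = g y}"
    using B(1) z(2) by (intro span_minimal) auto
  then show thesis using that[OF z(1)] B(3) by blast
qed

lemma adjoint:
  assumes D: "linear_on (carrier S) (smul S) (smul S) D" "D ` carrier S \<subseteq> carrier S"
    and x: "x \<in> carrier S"
  shows "adjoint S D x \<in> carrier S"
    and "y \<in> carrier S \<Longrightarrow> form S (adjoint S D x) y = form S x (D y)"
proof -
  have "linear_on (carrier S) (smul S) (*) (\<lambda>y. form S x (D y))"
    using D x unfolding linear_on_def
    by (auto simp: image_subset_iff form_add_right form_scale_right)
  then obtain z where z: "z \<in> carrier S" "\<And>y. y \<in> carrier S \<Longrightarrow> form S z y = form S x (D y)"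
    by (rule functional_representation) blast
  have unique: "w = z" if "w \<in> carrier S" "\<forall>y\<in>carrier S. form S w y = form S x (D y)" for w
  proof -
    have "w - z = 0"
      by (rule form_nondegenerate) (use that z in \<open>auto simp: form_diff_left carrier_diff\<close>)
    then show ?thesis by simp
  qed
  have "adjoint S D x = z"
    unfolding adjoint_def
  proof (rule the_equality)
    show "z \<in> carrier S \<and> (\<forall>y\<in>carrier S. form S z y = form S x (D y))"
      using z by simp
  next
    fix w assume "w \<in> carrier S \<and> (\<forall>y\<in>carrier S. form S w y = form S x (D y))"
    then show "w = z" using unique[of w] by simp
  qed
  then show "adjoint S D x \<in> carrier S"
    and "y \<in> carrier S \<Longrightarrow> form S (adjoint S D x) y = form S x (D y)"
    using z by auto
qed

end


section \<open>Symplectic reduction by a central isotropic line\<close>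

text \<open>
  The element \<open>es\<close> plays the role of \<open>e\<^sup>*\<close>. An even \<open>e\<close> is isotropic anyway, and an odd one becomes
  isotropic after subtracting a suitable multiple of \<open>es\<close>.
\<close>

locale hyperbolic_pair = even_symplectic S
  for S :: "('k::{alg_closed_field, field_char_0}, 'a::ab_group_add) symp_superalg" +
  fixes d :: bit and es e :: 'a
  assumes es_comp: "es \<in> comp S d" and e_comp: "e \<in> comp S d"
    and central: "x \<in> carrier S \<Longrightarrow> bracket S es x = 0"
    and form_es_e: "form S es e = 1" and form_es_es: "form S es es = 0"
    and form_e_e: "form S e e = 0"
begin

lemmas es_carrier = carrier_comp[OF es_comp]
  and e_carrier = carrier_comp[OF e_comp]

lemma form_e_es: "form S e es = - sg d"
  using form_swap[OF es_comp e_carrier] form_es_e by simp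

lemma central_right: "x \<in> carrier S \<Longrightarrow> bracket S x es = 0"
  using bracket_swap[OF es_comp] central[OF twist_carrier] by simp

lemma form_es_bracket: "x \<in> carrier S \<Longrightarrow> y \<in> carrier S \<Longrightarrow> form S es (bracket S x y) = 0"
  using form_bracket[OF es_comp, of x y] central zero_args twist_carrier by simp

lemma form_off_degree:
  assumes "x \<in> comp S p" "p \<noteq> d"
  shows "form S es x = 0" "form S e x = 0"
  using assms form_even es_comp e_comp by blast+

text \<open>
  The projection onto the orthogonal of \<open>es\<close> and \<open>e\<close> along their span. The sign comes from
  \<open>\<omega>(e, es) = - (-1)\<^sup>d\<close>: the \<open>es\<close>-coordinate of \<open>x\<close> is \<open>- (-1)\<^sup>d \<omega>(e, x)\<close>.
\<close>

definition proj :: "'a \<Rightarrow> 'a" where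
  "proj x = x - smul S (form S es x) e + smul S (sg d * form S e x) es"

text \<open>
  The quotient of the orthogonal of \<open>es\<close> by the line through \<open>es\<close>, represented by the orthogonal of the
  pair, so that the type of the elements stays the same.
\<close>

definition reduced :: "('k, 'a) symp_superalg" where
  "reduced = S\<lparr>comp := \<lambda>p. {x \<in> comp S p. form S es x = 0 \<and> form S e x = 0},
     bracket := \<lambda>x y. proj (bracket S x y)\<rparr>"

lemma reduced_simps [simp]:
  "smul reduced = smul S" "form reduced = form S"
  "bracket reduced = (\<lambda>x y. proj (bracket S x y))"
  "comp reduced p = {x \<in> comp S p. form S es x = 0 \<and> form S e x = 0}"
  by (simp_all add: reduced_def)

lemma carrier_reduced: "carrier reduced = {x \<in> carrier S. form S es x = 0 \<and> form S e x = 0}"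
proof (intro set_eqI iffI)
  fix x assume "x \<in> carrier reduced"
  then show "x \<in> {x \<in> carrier S. form S es x = 0 \<and> form S e x = 0}"
    by (auto simp: carrier_def[of reduced] carrier_comp carrier_add form_add_right es_carrier e_carrier)
next
  fix x assume x: "x \<in> {x \<in> carrier S. form S es x = 0 \<and> form S e x = 0}"
  then obtain u v where uv: "u \<in> comp S d" "v \<in> comp S (d + 1)" "x = u + v"
    using carrier_decompose by blast
  have v: "form S es v = 0" "form S e v = 0"
    using form_off_degree[OF uv(2)] by (auto simp: add_eq_0_iff)
  then have "form S es u = 0" "form S e u = 0"
    using x uv carrier_comp by (auto simp: form_add_right es_carrier e_carrier)
  with v uv have r: "u \<in> comp reduced d" "v \<in> comp reduced (d + 1)" by simp_all
  show "x \<in> carrier reduced"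
  proof (cases "d = 0")
    case True
    with r have "u \<in> comp reduced 0" "v \<in> comp reduced 1" by (simp_all only: add_0_left)
    then show ?thesis unfolding carrier_def[of reduced] uv(3) by blast
  next
    case False
    then have "d = 1" "d + 1 = 0" by simp_all
    with r have "v \<in> comp reduced 0" "u \<in> comp reduced 1" by (simp_all only:)
    moreover have "x = v + u" using uv(3) by (simp add: add.commute)
    ultimately show ?thesis unfolding carrier_def[of reduced] by blast
  qed
qed

lemma reducedD:
  assumes "x \<in> carrier reduced"
  shows "x \<in> carrier S" "form S es x = 0" "form S e x = 0" "form S x es = 0" "form S x e = 0"
  using assms form_swap[OF es_comp] form_swap[OF e_comp] by (auto simp: carrier_reduced)

lemma proj_carrier: "x \<in> carrier S \<Longrightarrow> proj x \<in> carrier S"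
  unfolding proj_def by (intro carrier_add carrier_diff carrier_scale es_carrier e_carrier)

lemma form_proj:
  assumes "x \<in> carrier S"
  shows "form S es (proj x) = 0" "form S e (proj x) = 0"
proof -
  have "sg d * sg d = (1::'k)" by (rule sg_mult_self)
  then show "form S es (proj x) = 0" "form S e (proj x) = 0"
    unfolding proj_def using assms
    by (simp_all add: form_add_right form_diff_right form_scale_right carrier_add carrier_diff
        carrier_scale es_carrier e_carrier form_es_e form_es_es form_e_e form_e_es)
qed

lemma proj_reduced: "x \<in> carrier S \<Longrightarrow> proj x \<in> carrier reduced"
  using proj_carrier form_proj by (simp add: carrier_reduced)

lemma proj_comp:
  assumes x: "x \<in> comp S p"
  shows "proj x \<in> comp reduced p"
proof -
  have "proj x \<in> comp S p"
  proof (cases "p = d")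
    case True
    then show ?thesis
      unfolding proj_def using x es_comp e_comp by (intro comp_add comp_diff comp_scale) auto
  next
    case False
    then show ?thesis
      unfolding proj_def using x form_off_degree[OF x False] by simp
  qed
  then show ?thesis using form_proj[OF carrier_comp[OF x]] by simp
qed

lemma proj_id: "x \<in> carrier reduced \<Longrightarrow> proj x = x"
  by (simp add: proj_def carrier_reduced)

lemma proj_add: "x \<in> carrier S \<Longrightarrow> y \<in> carrier S \<Longrightarrow> proj (x + y) = proj x + proj y"
  and proj_scale: "x \<in> carrier S \<Longrightarrow> proj (smul S c x) = smul S c (proj x)"
  by (simp_all add: proj_def form_add_right form_scale_right es_carrier e_carrier algebra_simps)

lemma proj_neg: "x \<in> carrier S \<Longrightarrow> proj (- x) = - proj x"
  using proj_scale[of x "-1"] by simp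

lemma proj_0: "proj 0 = 0"
  using proj_scale[of 0 0] carrier_0 by simp

lemma proj_bracket:
  assumes "x \<in> carrier S" "y \<in> carrier S"
  shows "proj (bracket S x y) = bracket S x y + smul S (sg d * form S e (bracket S x y)) es"
  using form_es_bracket[OF assms] by (simp add: proj_def)

text \<open>
  A bracket has no \<open>e\<close>-component, and its \<open>es\<close>-component is central, so projecting inside an outer
  bracket changes nothing. Identities between iterated brackets thus pass to the reduction.
\<close>

lemma bracket_proj:
  assumes "x \<in> carrier S" "y \<in> carrier S" "z \<in> carrier S"
  shows "bracket S x (proj (bracket S y z)) = bracket S x (bracket S y z)"
    and "bracket S (proj (bracket S y z)) x = bracket S (bracket S y z) x"
  using assms
  by (simp_all add: proj_bracket bracket_add_right bracket_add_left bracket_scale_right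
      bracket_scale_left bracket_carrier carrier_scale es_carrier central central_right)

lemma form_proj_reduced:
  assumes x: "x \<in> carrier reduced" and y: "y \<in> carrier S"
  shows "form S x (proj y) = form S x y" "form S (proj y) x = form S y x"
  unfolding proj_def using y reducedD[OF x]
  by (simp_all add: form_add_right form_diff_right form_scale_right
      form_add_left form_diff_left form_scale_left carrier_add carrier_diff
        carrier_scale es_carrier e_carrier)

lemma carrier_split: "x = smul S (- sg d * form S e x) es + proj x + smul S (form S es x) e"
  by (simp add: proj_def)

lemma lie_superalgebra_reduced: "lie_superalgebra reduced"
proof (intro lie_superalgebra.intro lie_superalgebra_axioms.intro)
  show "vector_space (smul reduced)"
    by (simp add: vector_space_axioms)
  fix p q r x y z
  show "module.subspace (smul reduced) (comp reduced p)"
    by (auto intro!: subspaceI comp_0 comp_add comp_scale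
        simp: zero_args es_carrier e_carrier form_add_right form_scale_right carrier_comp)
  show "comp reduced 0 \<inter> comp reduced 1 = {0}"
    using comp_disjoint by (auto simp: zero_args es_carrier e_carrier comp_0)
  have sub: "carrier reduced \<subseteq> carrier S" using reducedD(1) by blast
  have lin: "subspace (carrier reduced)"
    by (auto intro!: subspaceI carrier_0 carrier_add carrier_scale
        simp: carrier_reduced zero_args es_carrier e_carrier form_add_right form_scale_right)
  obtain C where C: "finite C" "span C = carrier S" using finite_dim by blast
  obtain B where B: "B \<subseteq> carrier reduced" "independent B" "carrier reduced \<subseteq> span B"
    by (rule basis_exists)
  have "finite B" using independent_span_bound[OF C(1) B(2)] B(1) C(2) sub by simp
  moreover have "span B = carrier reduced" using B(1,3) span_minimal[OF B(1) lin] by simp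
  ultimately show "\<exists>B. finite B \<and> module.span (smul reduced) B = carrier reduced" by auto
  show "bilinear_on (carrier reduced) (smul reduced) (smul reduced) (bracket reduced)"
    unfolding bilinear_on_def linear_on_def
    using sub
    by (simp add: subset_iff bracket_add_left bracket_add_right bracket_scale_left
        bracket_scale_right proj_add proj_scale bracket_carrier)
  show "bracket reduced x y \<in> comp reduced (p + q)" if "x \<in> comp reduced p" "y \<in> comp reduced q"
    using that proj_comp[OF bracket_degree[of x p y q]] by simp
  show "bracket reduced x y = - smul reduced (sg (p * q)) (bracket reduced y x)"
    if "x \<in> comp reduced p" "y \<in> comp reduced q"
  proof -
    have h: "x \<in> comp S p" "y \<in> comp S q" using that by auto
    have "bracket S y x \<in> carrier S" using h bracket_carrier carrier_comp by blast
    then have "proj (- smul S (sg (p * q)) (bracket S y x)) = - smul S (sg (p * q)) (proj (bracket S y x))"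
      by (simp only: proj_neg proj_scale carrier_scale)
    then show ?thesis by (simp only: reduced_simps bracket_skew[OF h])
  qed
  show "smul reduced (sg (r * p)) (bracket reduced x (bracket reduced y z))
      + smul reduced (sg (p * q)) (bracket reduced y (bracket reduced z x))
      + smul reduced (sg (q * r)) (bracket reduced z (bracket reduced x y)) = 0"
    if "x \<in> comp reduced p" "y \<in> comp reduced q" "z \<in> comp reduced r"
  proof -
    have h: "x \<in> comp S p" "y \<in> comp S q" "z \<in> comp S r" using that by auto
    note car = carrier_comp[OF h(1)] carrier_comp[OF h(2)] carrier_comp[OF h(3)]
    have "proj (smul S (sg (r * p)) (bracket S x (bracket S y z))
      + smul S (sg (p * q)) (bracket S y (bracket S z x))
      + smul S (sg (q * r)) (bracket S z (bracket S x y))) = 0"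
      using jacobi[OF h] proj_0 by simp
    then show ?thesis
      by (simp add: proj_add proj_scale bracket_proj car bracket_carrier carrier_scale carrier_add)
  qed
qed

lemma even_symplectic_reduced: "even_symplectic reduced"
proof (intro even_symplectic.intro even_symplectic_axioms.intro lie_superalgebra_reduced)
  have sub: "carrier reduced \<subseteq> carrier S" using reducedD(1) by blast
  fix p q r x y z
  show "bilinear_on (carrier reduced) (smul reduced) (*) (form reduced)"
    unfolding bilinear_on_def linear_on_def
    using sub
    by (simp add: subset_iff form_add_left form_add_right form_scale_left form_scale_right)
  show "form reduced x y = 0" if "x \<in> comp reduced p" "y \<in> comp reduced q" "p \<noteq> q"
    using that form_even[of x p y q] by simp
  show "form reduced x y = - sg (p * q) * form reduced y x"
    if "x \<in> comp reduced p" "y \<in> comp reduced q"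
    using that form_skew[of x p y q] by simp
  show "sg (r * p) * form reduced x (bracket reduced y z)
      + sg (p * q) * form reduced y (bracket reduced z x)
      + sg (q * r) * form reduced z (bracket reduced x y) = 0"
    if h: "x \<in> comp reduced p" "y \<in> comp reduced q" "z \<in> comp reduced r"
  proof -
    have hS: "x \<in> comp S p" "y \<in> comp S q" "z \<in> comp S r" using h by auto
    have red: "x \<in> carrier reduced" "y \<in> carrier reduced" "z \<in> carrier reduced"
      using h by (auto simp: carrier_reduced carrier_comp)
    note car = reducedD(1)[OF red(1)] reducedD(1)[OF red(2)] reducedD(1)[OF red(3)]
    show ?thesis
      unfolding reduced_simps
      by (simp only: form_proj_reduced(1)[OF red(1)] form_proj_reduced(1)[OF red(2)]
          form_proj_reduced(1)[OF red(3)] bracket_carrier car form_closed[OF hS])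
  qed
  show "x = 0" if x: "x \<in> carrier reduced"
    and z: "\<And>y. y \<in> carrier reduced \<Longrightarrow> form reduced x y = 0"
  proof (rule form_nondegenerate)
    fix y assume y: "y \<in> carrier S"
    have "form S x y = form S x (proj y)" using form_proj_reduced[OF x y] by simp
    also have "\<dots> = 0" using z[OF proj_reduced[OF y]] by simp
    finally show "form S x y = 0" .
  qed (use x sub in blast)
qed

lemma dim_reduced: "dim (carrier reduced) < dim (carrier S)"
proof -
  obtain C where C: "finite C" "span C = carrier S" using finite_dim by blast
  interpret R: even_symplectic reduced by (rule even_symplectic_reduced)
  have "e \<in> carrier S - carrier reduced"
    using e_carrier form_es_e by (simp add: carrier_reduced)
  then have "carrier reduced \<subset> carrier S" using reducedD(1) by blast
  then show ?thesis
    using dim_psubset_subspace[of "carrier reduced" "carrier S" C] R.subspace_carrier C by simp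
qed

text \<open>
  The representatives in \<open>reduced\<close> agree with elements of the lower central series only up to multiples
  of \<open>es\<close>. These vanish in the next bracket because \<open>es\<close> is central.
\<close>

lemma lower_central_reduced:
  "lower_central reduced n \<subseteq>
     {x \<in> carrier reduced. \<exists>t. x + smul S t es \<in> lower_central S n}" (is "_ \<subseteq> ?K n")
proof (induction n)
  case 0
  show ?case
  proof
    fix x assume "x \<in> lower_central reduced 0"
    then have x: "x \<in> carrier reduced" by simp
    then have "x + smul S 0 es \<in> lower_central S 0" using reducedD(1) by simp
    with x show "x \<in> ?K 0" by blast
  qed
next
  case (Suc n)
  interpret R: even_symplectic reduced by (rule even_symplectic_reduced)
  let ?W = "lower_central S (Suc n)"
  have W: "subspace ?W" unfolding lower_central.simps by (rule subspace_span)
  have K: "subspace (?K (Suc n))"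
  proof (rule subspaceI)
    show "0 \<in> ?K (Suc n)"
    proof (intro CollectI conjI exI)
      show "0 + smul S 0 es \<in> ?W" using subspace_0[OF W] by (simp only: scale_zero_left add_0_right)
    qed (rule R.carrier_0)
  next
    fix x y assume "x \<in> ?K (Suc n)" "y \<in> ?K (Suc n)"
    then obtain s t where st: "x \<in> carrier reduced" "y \<in> carrier reduced"
      "x + smul S s es \<in> ?W" "y + smul S t es \<in> ?W" by blast
    have "(x + y) + smul S (s + t) es = (x + smul S s es) + (y + smul S t es)"
      by (simp add: scale_left_distrib algebra_simps)
    also have "\<dots> \<in> ?W" using subspace_add[OF W] st by blast
    finally show "x + y \<in> ?K (Suc n)" using R.carrier_add st by blast
  next
    fix c x assume "x \<in> ?K (Suc n)"
    then obtain s where s: "x \<in> carrier reduced" "x + smul S s es \<in> ?W" by blast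
    have "smul S c x + smul S (c * s) es = smul S c (x + smul S s es)"
      by (simp add: scale_right_distrib)
    also have "\<dots> \<in> ?W" using subspace_scale[OF W] s by blast
    finally show "smul S c x \<in> ?K (Suc n)" using R.carrier_scale[of x c] s by auto
  qed
  have "proj (bracket S x y) \<in> ?K (Suc n)"
    if x: "x \<in> carrier reduced" and y: "y \<in> lower_central reduced n" for x y
  proof -
    obtain t where t: "y \<in> carrier reduced" "y + smul S t es \<in> lower_central S n"
      using y Suc.IH by blast
    have car: "x \<in> carrier S" "y \<in> carrier S" using x t reducedD(1) by blast+
    have "bracket S x (y + smul S t es) = bracket S x y"
      using car by (simp add: bracket_add_right bracket_scale_right carrier_scale es_carrier central_right)
    then have "bracket S x y \<in> ?W"
      using car(1) t(2) unfolding lower_central.simps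
      by (intro span_base CollectI exI[of _ x] exI[of _ "y + smul S t es"]) simp
    moreover have "proj (bracket S x y) + smul S (- sg d * form S e (bracket S x y)) es = bracket S x y"
      using proj_bracket[OF car] by simp
    ultimately have "\<exists>s. proj (bracket S x y) + smul S s es \<in> ?W" by metis
    then show ?thesis using proj_reduced[OF bracket_carrier[OF car]] by blast
  qed
  then show ?case
    unfolding lower_central.simps(2)[of reduced] reduced_simps by (intro span_minimal[OF _ K]) blast
qed

lemma nilpotent_reduced:
  assumes "nilpotent S"
  shows "nilpotent reduced"
proof -
  interpret R: even_symplectic reduced by (rule even_symplectic_reduced)
  obtain n where n: "lower_central S n = {0}" using assms unfolding nilpotent_def by blast
  have "x = 0" if x: "x \<in> lower_central reduced n" for x
  proof -
    have "x \<in> carrier reduced" "\<exists>t. x + smul S t es \<in> lower_central S n"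
      using subsetD[OF lower_central_reduced x] by simp_all
    then obtain t where t: "x \<in> carrier reduced" "x + smul S t es = 0" by (auto simp: n)
    have "x = smul S (- t) es" using t(2) by (simp add: eq_neg_iff_add_eq_0)
    moreover have "form S e (smul S (- t) es) = t * sg d"
      by (simp only: form_scale_right e_carrier es_carrier form_e_es) simp
    ultimately have "t * sg d = 0" using reducedD(3)[OF t(1)] by simp
    then have "t = 0" by (auto simp: sg_def split: if_splits)
    then show ?thesis using t(2) by simp
  qed
  moreover have "0 \<in> lower_central reduced n"
  proof (cases n)
    case 0 then show ?thesis using R.carrier_0 by simp
  next
    case (Suc m) then show ?thesis by (simp add: span_zero)
  qed
  ultimately have "lower_central reduced n = {0}" by blast
  then show ?thesis unfolding nilpotent_def by blast
qed


section \<open>A superalgebra as an extension of its reduction\<close>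

lemma reduced_twist: "x \<in> carrier reduced \<Longrightarrow> twist reduced k x = twist S k x"
proof -
  interpret R: even_symplectic reduced by (rule even_symplectic_reduced)
  assume "x \<in> carrier reduced"
  then obtain u v where uv: "u \<in> comp reduced 0" "v \<in> comp reduced 1" "x = u + v"
    unfolding carrier_def by blast
  then show ?thesis
    using R.twist_decomposed[OF uv(1,2)] twist_decomposed[of u v] by simp
qed

definition der :: "'a \<Rightarrow> 'a" where
  "der x = proj (bracket S e x)"

lemma der_reduced: "x \<in> carrier S \<Longrightarrow> der x \<in> carrier reduced"
  by (simp add: der_def proj_reduced bracket_carrier e_carrier)

lemma der_proj_bracket:
  assumes "x \<in> carrier S" "y \<in> carrier S"
  shows "der (proj (bracket S x y)) = proj (bracket S e (bracket S x y))"
  using assms by (simp add: der_def bracket_proj e_carrier)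

lemma superderivation_der: "superderivation reduced d der"
  unfolding superderivation_def
proof (intro conjI allI ballI)
  show "linear_on (carrier reduced) (smul reduced) (smul reduced) der"
    unfolding linear_on_def using reducedD(1)
    by (simp add: der_def bracket_add_right bracket_scale_right proj_add proj_scale bracket_carrier
        e_carrier)
  show "der ` comp reduced p \<subseteq> comp reduced (p + d)" for p
  proof
    fix y assume "y \<in> der ` comp reduced p"
    then obtain x where x: "x \<in> comp S p" "y = der x" by auto
    have "bracket S e x \<in> comp S (p + d)"
      using bracket_degree[OF e_comp x(1)] by (simp only: add.commute)
    then show "y \<in> comp reduced (p + d)" unfolding x(2) der_def by (rule proj_comp)
  qed
  fix p q x y assume h: "x \<in> comp reduced p" "y \<in> comp reduced q"
  then have hS: "x \<in> comp S p" "y \<in> comp S q" by auto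
  note car = carrier_comp[OF hS(1)] carrier_comp[OF hS(2)] e_carrier
  show "der (bracket reduced x y) =
      bracket reduced (der x) y + smul reduced (sg (d * p)) (bracket reduced x (der y))"
    unfolding reduced_simps der_proj_bracket[OF car(1,2)] bracket_leibniz[OF e_comp hS(1) car(2)]
    unfolding der_def
    by (simp only: proj_add proj_scale bracket_proj car bracket_carrier carrier_scale)
qed

text \<open>
  The left-hand side is the \<open>es\<close>-component of \<open>[x, y]\<close>, so this identifies it with the cocycle of the
  extension.
\<close>

lemma form_e_bracket:
  assumes x: "x \<in> carrier reduced" and y: "y \<in> carrier reduced"
  shows "- sg d * form S e (bracket S x y) = ext_gamma reduced d der x y"
proof -
  interpret R: even_symplectic reduced by (rule even_symplectic_reduced)
  have tw: "twist S d x \<in> carrier reduced"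
    using R.twist_carrier[OF x] reduced_twist[OF x] by simp
  show ?thesis
    using x y tw reducedD(1)[OF x] reducedD(1)[OF y]
    by (simp add: ext_gamma_def der_def reduced_twist form_proj_reduced bracket_carrier e_carrier
        form_bracket[OF e_comp])
qed

text \<open>
  For even \<open>e\<close> the bracket \<open>[e, e]\<close> is zero; for odd \<open>e\<close> it is even and therefore orthogonal to the odd
  elements \<open>e\<close> and \<open>es\<close>. Either way no projection is needed to get into the reduction.
\<close>

lemma bracket_e_e_comp: "bracket S e e \<in> comp reduced 0"
proof -
  have c: "bracket S e e \<in> comp S 0"
    using bracket_degree[OF e_comp e_comp] by simp
  have "form S e (bracket S e e) = 0"
  proof (cases "d = 0")
    case True
    then have "bracket S e e = 0" using bracket_even_self e_comp by simp
    then show ?thesis by (simp add: zero_args e_carrier)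
  next
    case False
    then show ?thesis using form_even[OF e_comp c] by simp
  qed
  then show ?thesis using c form_es_bracket[OF e_carrier e_carrier] by simp
qed

lemma bracket_split:
  assumes x: "x \<in> carrier S" and y: "y \<in> carrier S"
  shows "bracket S x y = bracket S (proj x) (proj y)
    + smul S (form S es x) (bracket S e (proj y))
    - smul S (form S es y) (bracket S e (twist S d (proj x)))
    + smul S (form S es x * form S es y) (bracket S e e)"
proof -
  note car = proj_carrier[OF x] proj_carrier[OF y] es_carrier e_carrier carrier_scale carrier_add
  have expand: "bracket S (smul S a es + h + smul S b e) (smul S a' es + h' + smul S b' e) =
      bracket S h h' + smul S b (bracket S e h') + smul S b' (bracket S h e)
      + smul S (b * b') (bracket S e e)"
    if "h \<in> carrier S" "h' \<in> carrier S" for a a' b b' h h'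
    using that
    by (simp add: car bracket_add_left bracket_add_right bracket_scale_left bracket_scale_right
        central central_right scale_right_distrib algebra_simps)
  have "bracket S x y = bracket S (proj x) (proj y) + smul S (form S es x) (bracket S e (proj y))
      + smul S (form S es y) (bracket S (proj x) e)
      + smul S (form S es x * form S es y) (bracket S e e)"
    using expand[OF car(1,2), of "- sg d * form S e x" "form S es x" "- sg d * form S e y" "form S es y"]
    by (simp only: carrier_split[symmetric])
  then show ?thesis
    by (simp add: bracket_swap[OF e_comp] car)
qed

lemma form_split:
  assumes x: "x \<in> carrier S" and y: "y \<in> carrier S"
  shows "form S x y = form S (proj x) (proj y) - sg d * form S e x * form S es y
    + form S es x * form S e y"
proof -
  note red = proj_reduced[OF x] proj_reduced[OF y]
  note car = reducedD[OF red(1)] reducedD[OF red(2)] es_carrier e_carrier carrier_scale carrier_add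
  have expand: "form S (smul S a es + h + smul S b e) (smul S a' es + h' + smul S b' e) =
      form S h h' + a * b' - sg d * b * a'"
    if "h \<in> carrier reduced" "h' \<in> carrier reduced" for a a' b b' h h'
    using reducedD[OF that(1)] reducedD[OF that(2)]
    by (simp add: car form_add_left form_add_right form_scale_left form_scale_right
        form_es_e form_es_es form_e_e form_e_es)
  have "form S x y = form S (proj x) (proj y) + - sg d * form S e x * form S es y
    - sg d * form S es x * (- sg d * form S e y)"
    using expand[OF red, of "- sg d * form S e x" "form S es x" "- sg d * form S e y" "form S es y"]
    by (simp only: carrier_split[symmetric])
  moreover have "(sg d * form S es x) * (sg d * form S e y) = (sg d * sg d) * (form S es x * form S e y)"
    by (simp only: mult_ac)
  ultimately show ?thesis by (simp add: sg_mult_self)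
qed

lemma proj_diff: "x \<in> carrier S \<Longrightarrow> y \<in> carrier S \<Longrightarrow> proj (x - y) = proj x - proj y"
  using proj_add[of x "- y"] proj_neg[of y] carrier_neg by simp

lemma carrier_extension: "carrier (extension reduced d D c f) = {(a, x, b). x \<in> carrier reduced}"
proof (intro set_eqI iffI)
  fix w :: "'k \<times> 'a \<times> 'k"
  assume "w \<in> carrier (extension reduced d D c f)"
  then obtain u v where uv: "u \<in> comp (extension reduced d D c f) 0"
    "v \<in> comp (extension reduced d D c f) 1" "w = u + v"
    unfolding carrier_def[of "extension reduced d D c f"] by blast
  then have "fst (snd u) \<in> comp reduced 0" "fst (snd v) \<in> comp reduced 1"
    by (auto simp: extension_def)
  then have "fst (snd w) \<in> carrier reduced"
    unfolding uv(3) carrier_def[of reduced] by auto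
  then show "w \<in> {(a, x, b). x \<in> carrier reduced}" by (cases w) simp
next
  fix w :: "'k \<times> 'a \<times> 'k"
  assume "w \<in> {(a, x, b). x \<in> carrier reduced}"
  then obtain a x b where w: "w = (a, x, b)" "x \<in> carrier reduced" by auto
  then obtain u v where uv: "u \<in> comp reduced 0" "v \<in> comp reduced 1" "x = u + v"
    unfolding carrier_def by blast
  show "w \<in> carrier (extension reduced d D c f)"
  proof (cases "d = 0")
    case True
    then have "(a, u, b) \<in> comp (extension reduced d D c f) 0"
      "(0, v, 0) \<in> comp (extension reduced d D c f) 1"
      using uv by (auto simp: extension_def)
    moreover have "w = (a, u, b) + (0, v, 0)" using uv w by simp
    ultimately show ?thesis unfolding carrier_def[of "extension reduced d D c f"] by blast
  next
    case False
    then have "(0, u, 0) \<in> comp (extension reduced d D c f) 0"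
      "(a, v, b) \<in> comp (extension reduced d D c f) 1"
      using uv by (auto simp: extension_def)
    moreover have "w = (0, u, 0) + (a, v, b)" using uv w by simp
    ultimately show ?thesis unfolding carrier_def[of "extension reduced d D c f"] by blast
  qed
qed

text \<open>The inverse of \<open>(a, h, b) \<mapsto> a es + h + b e\<close>.\<close>

definition coords :: "'a \<Rightarrow> 'k \<times> 'a \<times> 'k" where
  "coords x = (- sg d * form S e x, proj x, form S es x)"

lemma coords_inverse:
  fixes a b :: 'k
  assumes h: "h \<in> carrier reduced"
  defines "x \<equiv> smul S a es + h + smul S b e"
  shows "x \<in> carrier S" "coords x = (a, h, b)"
proof -
  note car = reducedD[OF h] es_carrier e_carrier carrier_scale carrier_add
  show "x \<in> carrier S" unfolding x_def by (simp add: car)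
  have 1: "form S es x = b"
    unfolding x_def by (simp add: car form_add_right form_scale_right form_es_e form_es_es)
  have "form S e x = - (sg d * a)"
    unfolding x_def by (simp add: car form_add_right form_scale_right form_e_e form_e_es)
  then have "- sg d * form S e x = (sg d * sg d) * a" by simp
  then have 2: "- sg d * form S e x = a" by (simp only: sg_mult_self mult_1)
  then have "sg d * form S e x = - a" by (simp add: minus_equation_iff)
  then have "proj x = x - smul S b e + smul S (- a) es"
    unfolding proj_def 1 by simp
  also have "\<dots> = h" unfolding x_def by simp
  finally show "coords x = (a, h, b)" unfolding coords_def 1 2 by simp
qed

text \<open>
  The two cases differ only in how the \<open>es\<close>-component \<open>f\<close> of \<open>[e, \<cdot>]\<close> is expressed through the form, so
  the isomorphism is established for both degrees at once.
\<close>

lemma symp_isomorphic_extension: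
  assumes f: "\<And>x. x \<in> carrier reduced \<Longrightarrow> f x = - sg d * form S e (bracket S e x)"
  shows "symp_isomorphic S (extension reduced d der (bracket S e e) f)"
    (is "symp_isomorphic S ?T")
proof -
  interpret R: even_symplectic reduced by (rule even_symplectic_reduced)
  have split: "x = (case coords x of (a, h, b) \<Rightarrow> smul S a es + h + smul S b e)" for x
    unfolding coords_def prod.case by (rule carrier_split)
  have "bij_betw coords (carrier S) (carrier ?T)"
  proof (rule bij_betwI)
    show "coords \<in> carrier S \<rightarrow> carrier ?T"
      by (auto simp: coords_def carrier_extension proj_reduced)
    show "(\<lambda>(a, h, b). smul S a es + h + smul S b e) \<in> carrier ?T \<rightarrow> carrier S"
      using coords_inverse(1) by (auto simp: carrier_extension)
    show "(\<lambda>(a, h, b). smul S a es + h + smul S b e) (coords x) = x" if "x \<in> carrier S" for x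
      using split[of x] by simp
    show "coords ((\<lambda>(a, h, b). smul S a es + h + smul S b e) w) = w" if "w \<in> carrier ?T" for w
      using that coords_inverse(2) by (auto simp: carrier_extension)
  qed
  moreover have "linear_on (carrier S) (smul S) (smul ?T) coords"
    unfolding linear_on_def
    by (simp add: coords_def extension_def form_add_right form_scale_right es_carrier e_carrier
        proj_add proj_scale algebra_simps)
  moreover have "coords ` comp S p = comp ?T p" for p
  proof (intro equalityI subsetI)
    fix w assume "w \<in> coords ` comp S p"
    then obtain x where x: "x \<in> comp S p" "w = coords x" by blast
    then show "w \<in> comp ?T p"
      using proj_comp[OF x(1)] form_off_degree[OF x(1)] by (auto simp: extension_def coords_def)
  next
    fix w assume "w \<in> comp ?T p"
    then obtain a h b where w: "w = (a, h, b)" "h \<in> comp reduced p" "p \<noteq> d \<longrightarrow> a = 0 \<and> b = 0"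
      by (auto simp: extension_def)
    have "smul S a es + h + smul S b e \<in> comp S p"
    proof (cases "p = d")
      case True
      then show ?thesis using w(2) es_comp e_comp comp_add comp_scale by simp
    next
      case False
      then show ?thesis using w(2,3) by simp
    qed
    moreover have "coords (smul S a es + h + smul S b e) = w"
      unfolding w(1) using R.carrier_comp[OF w(2)] by (rule coords_inverse(2))
    ultimately show "w \<in> coords ` comp S p" by (metis imageI)
  qed
  moreover have "coords (bracket S x y) = bracket ?T (coords x) (coords y)"
    if x: "x \<in> carrier S" and y: "y \<in> carrier S" for x y
  proof -
    note px = proj_reduced[OF x] and py = proj_reduced[OF y]
    have tw: "twist S d (proj x) \<in> carrier reduced"
      using R.twist_carrier[OF px] reduced_twist[OF px] by simp
    note car = reducedD(1)[OF px] reducedD(1)[OF py] reducedD(1)[OF tw] e_carrier es_carrier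
    have ee: "proj (bracket S e e) = bracket S e e" "form S e (bracket S e e) = 0"
      using proj_id[OF R.carrier_comp[OF bracket_e_e_comp]] bracket_e_e_comp by simp_all
    have "proj (bracket S x y) = smul S (form S es x * form S es y) (bracket S e e)
        + smul S (form S es x) (der (proj y)) - smul S (form S es y) (der (twist S d (proj x)))
        + proj (bracket S (proj x) (proj y))"
      unfolding bracket_split[OF x y]
      by (simp only: proj_add proj_diff proj_scale car bracket_carrier carrier_scale carrier_add
          carrier_diff der_def ee) (simp add: algebra_simps)
    moreover have "- sg d * form S e (bracket S x y) =
        form S es x * f (proj y) - form S es y * f (twist S d (proj x))
        + ext_gamma reduced d der (proj x) (proj y)"
      unfolding bracket_split[OF x y] form_e_bracket[OF px py, symmetric] f[OF py] f[OF tw]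
      by (simp only: form_add_right form_diff_right form_scale_right car bracket_carrier
          carrier_scale carrier_add carrier_diff ee) (simp add: algebra_simps)
    moreover have "form S es (bracket S x y) = 0" by (rule form_es_bracket[OF x y])
    ultimately show ?thesis
      by (simp add: coords_def extension_def reduced_twist[OF px])
  qed
  moreover have "form ?T (coords x) (coords y) = form S x y"
    if "x \<in> carrier S" "y \<in> carrier S" for x y
  proof -
    have "(sg d * form S es x) * (sg d * form S e y) = (sg d * sg d) * (form S es x * form S e y)"
      by (simp only: mult_ac)
    then show ?thesis
      unfolding form_split[OF that]
      by (simp add: coords_def extension_def sg_mult_self mult_ac)
  qed
  ultimately show ?thesis unfolding symp_isomorphic_def by blast
qed

text \<open>
  For odd \<open>e\<close> the derivation rule reads \<open>[e, [e, x]] = [[e, e], x] - [e, [e, x]]\<close>. It gives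
  \<open>D\<^sup>2 = 1/2 [x\<^sub>0, \<cdot>]\<close>, and for \<open>x = e\<close> also \<open>3 [e, [e, e]] = 0\<close>, hence \<open>D x\<^sub>0 = 0\<close>. Closedness of the
  form applied to \<open>e, e, x\<close> yields \<open>2 \<omega>(e, [e, x]) = \<omega>(x\<^sub>0, x)\<close>, the functional in the extension.
\<close>

lemma gen_double_extension_step:
  assumes d: "d = 1"
  shows "extension_step reduced S"
proof -
  let ?x0 = "bracket S e e"
  have x0: "?x0 \<in> comp reduced 0" by (rule bracket_e_e_comp)
  have e1: "e \<in> comp S 1" using e_comp d by simp
  have sder: "superderivation reduced 1 der"
    using superderivation_der by (simp only: d[symmetric])
  have leib: "bracket S e (bracket S e x) = smul S (1 / 2) (bracket S ?x0 x)" if "x \<in> carrier S" for x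
  proof -
    have "bracket S e (bracket S e x) = bracket S ?x0 x - bracket S e (bracket S e x)"
      using bracket_leibniz[OF e1 e1 that] by (simp add: sg_def)
    then have "bracket S ?x0 x = smul S 2 (bracket S e (bracket S e x))"
      using scale_left_distrib[of 1 1 "bracket S e (bracket S e x)"] by (simp add: algebra_simps)
    then show ?thesis by simp
  qed
  have "bracket S e ?x0 = 0"
  proof -
    have "bracket S e ?x0 = smul S (1 / 2) (bracket S ?x0 e)" by (rule leib[OF e_carrier])
    moreover have "bracket S ?x0 e = - bracket S e ?x0"
      using x0 bracket_skew[of ?x0 0 e 1] e1 by (simp add: sg_def)
    ultimately have "bracket S e ?x0 = - smul S (1 / 2) (bracket S e ?x0)" by simp
    then have "bracket S e ?x0 + smul S (1 / 2) (bracket S e ?x0) = 0"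
      by (simp only: eq_neg_iff_add_eq_0)
    then have "smul S (3 / 2) (bracket S e ?x0) = 0"
      using scale_left_distrib[of 1 "1 / 2" "bracket S e ?x0"] by simp
    then show ?thesis by simp
  qed
  then have "der ?x0 = 0" by (simp add: der_def proj_0)
  moreover have "form S ?x0 ?x0 = 0" using form_even_self x0 by simp
  moreover have "der (der x) = smul S (1 / 2) (proj (bracket S ?x0 x))" if "x \<in> carrier reduced" for x
  proof -
    have x: "x \<in> carrier S" using reducedD(1)[OF that] .
    have "der (der x) = proj (bracket S e (bracket S e x))"
      using der_proj_bracket[OF e_carrier x] by (simp only: der_def)
    then show ?thesis
      using leib[OF x] by (simp add: proj_scale bracket_carrier e_carrier x)
  qed
  ultimately have "gen_double_extension_data reduced der ?x0"
    using sder x0 unfolding gen_double_extension_data_def by simp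
  moreover have "symp_isomorphic S (gen_double_extension reduced der ?x0)"
    unfolding gen_double_extension_def d[symmetric]
  proof (rule symp_isomorphic_extension)
    fix x assume "x \<in> carrier reduced"
    then have x: "x \<in> carrier S" by (rule reducedD)
    have "twist S d e = - e"
      using twist_homogeneous[OF e1, of d] d by (simp add: sg_def)
    then have "form S e (bracket S e x) = form S ?x0 x - form S e (bracket S e x)"
      using form_bracket[OF e_comp e_carrier x] by (simp add: form_neg_left bracket_carrier e_carrier x)
    moreover have "sg d = (- 1 :: 'k)" using d by (simp add: sg_def)
    ultimately show "1 / 2 * form reduced ?x0 x = - sg d * form S e (bracket S e x)"
      by (simp add: field_simps)
  qed
  ultimately show ?thesis
    unfolding extension_step_def using even_symplectic_reduced by blast
qed

text \<open>
  For even \<open>e\<close> let \<open>b\<close> represent the \<open>es\<close>-component of \<open>[e, \<cdot>]\<close>. Moving adjoints to the other side,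
  the condition required of \<open>b\<close> becomes
  \<open>\<omega>(e, [e, [x, y]]) = \<omega>(D\<^sup>2 x, y) + 2 \<omega>(D x, D y) + \<omega>(x, D\<^sup>2 y)\<close>. This is the derivation rule for
  \<open>[e, [x, y]]\<close> followed by two uses of \<open>\<omega>(e, [x, y]) = \<omega>(D x, y) + \<omega>(x, D y)\<close>.
\<close>

lemma double_extension_step:
  assumes d: "d = 0"
  shows "extension_step reduced S"
proof -
  interpret R: even_symplectic reduced by (rule even_symplectic_reduced)
  have e0: "e \<in> comp S 0" using e_comp d by simp
  have ee: "bracket S e e = 0" by (rule bracket_even_self[OF e0])
  define g where "g x = - form S e (bracket S e x)" for x
  have "linear_on (carrier reduced) (smul reduced) (*) g"
    unfolding linear_on_def g_def using reducedD(1)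
    by (simp add: bracket_add_right bracket_scale_right form_add_right form_scale_right
        bracket_carrier e_carrier)
  then obtain z where z: "z \<in> carrier reduced" "\<And>y. y \<in> carrier reduced \<Longrightarrow> form reduced z y = g y"
    by (rule R.functional_representation) blast
  \<comment> \<open>The functional \<open>g\<close> vanishes on odd elements, so the even part of \<open>z\<close> represents it as well.\<close>
  obtain b v where bv: "b \<in> comp reduced 0" "v \<in> comp reduced 1" "z = b + v"
    using z(1) unfolding carrier_def by blast
  have b: "form S b y = g y" if "y \<in> carrier reduced" for y
    using that
  proof (induction rule: R.carrier_induct)
    case (homogeneous p y)
    note car = R.carrier_comp[OF bv(1)] R.carrier_comp[OF bv(2)] R.carrier_comp[OF homogeneous]
    show ?case
    proof (cases "p = 0")
      case True
      then have "form S v y = 0" using R.form_even[OF bv(2) homogeneous] by simp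
      then show ?thesis
        using z(2)[OF car(3)] R.form_add_left[OF car] unfolding bv(3) by simp
    next
      case False
      then have p: "p = 1" by simp
      have "form S b y = 0" using R.form_even[OF bv(1) homogeneous] p by simp
      moreover have "bracket S e y \<in> comp S 1"
        using bracket_degree[OF e0, of y 1] homogeneous p by simp
      then have "g y = 0" unfolding g_def using form_even[OF e0] by simp
      ultimately show ?thesis by simp
    qed
  next
    case (add u v)
    then show ?case
      using R.carrier_comp[OF bv(1)] reducedD(1)
      by (simp add: g_def form_add_right bracket_add_right e_carrier bracket_carrier)
  qed
  have sder: "superderivation reduced 0 der" using superderivation_der d by simp
  have lin: "linear_on (carrier reduced) (smul reduced) (smul reduced) der"
    using sder unfolding superderivation_def by blast
  have img: "der ` carrier reduced \<subseteq> carrier reduced"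
    using der_reduced reducedD(1) by blast
  let ?A = "adjoint reduced der"
  have "- form S (?A (der x + ?A x) + (der (der x) + ?A (der x))) y = form S b (proj (bracket S x y))"
    if x: "x \<in> carrier reduced" and y: "y \<in> carrier reduced" for x y
  proof -
    have D: "der w \<in> carrier reduced" if "w \<in> carrier reduced" for w using that img by blast
    have A: "?A w \<in> carrier reduced" if "w \<in> carrier reduced" for w
      by (rule R.adjoint(1)[OF lin img that])
    have FA: "form S (?A w) y = form S w (der y)" if "w \<in> carrier reduced" "y \<in> carrier reduced" for w y
      using R.adjoint(2)[OF lin img that] by simp
    note add = R.form_add_left[unfolded reduced_simps]
    have lhs: "form S (?A (der x + ?A x) + (der (der x) + ?A (der x))) y =
        form S (der x) (der y) + form S x (der (der y)) + form S (der (der x)) y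
        + form S (der x) (der y)"
      using x y by (simp add: add FA D A R.carrier_add)
    have brk: "form S e (bracket S x y) = form S (der x) y + form S x (der y)"
      if "x \<in> carrier reduced" "y \<in> carrier reduced" for x y
    proof -
      have "twist S 0 x = x" by (rule twist_zero_degree[OF reducedD(1)[OF that(1)]])
      then show ?thesis
        using form_bracket[OF e0, of x y] reducedD(1)[OF that(1)] reducedD(1)[OF that(2)] that
        by (simp add: der_def form_proj_reduced bracket_carrier e_carrier)
    qed
    note car = reducedD(1)[OF x] reducedD(1)[OF y] e_carrier
    have "bracket S e (bracket S x y) = bracket S (bracket S e x) y + bracket S x (bracket S e y)"
      using bracket_leibniz_twist[OF e0 car(1,2)] twist_zero_degree[OF car(1)] by simp
    also have "\<dots> = bracket S (der x) y + bracket S x (der y)"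
      unfolding der_def by (simp only: bracket_proj car)
    finally have "form S e (bracket S e (bracket S x y)) =
        form S e (bracket S (der x) y) + form S e (bracket S x (der y))"
      using x y by (simp add: form_add_right bracket_carrier car D reducedD(1))
    also have "\<dots> = form S (der (der x)) y + form S (der x) (der y)
        + (form S (der x) (der y) + form S x (der (der y)))"
      using x y by (simp only: brk D)
    finally have "form S e (bracket S e (bracket S x y)) = \<dots>" .
    moreover have "form S b (proj (bracket S x y)) = - form S e (bracket S e (bracket S x y))"
      using b[OF proj_reduced[OF bracket_carrier[OF car(1,2)]]]
      by (simp only: g_def bracket_proj car)
    ultimately show ?thesis unfolding lhs by simp
  qed
  then have "double_extension_data reduced der b"
    using sder bv(1) unfolding double_extension_data_def by simp
  moreover have "symp_isomorphic S (double_extension reduced der b)"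
  proof -
    have sg: "sg d = (1::'k)" using d by (simp add: sg_def)
    have "symp_isomorphic S (extension reduced d der (bracket S e e) (\<lambda>x. form reduced b x))"
      by (rule symp_isomorphic_extension) (simp add: b g_def sg)
    then show ?thesis by (simp only: double_extension_def ee d[symmetric])
  qed
  ultimately show ?thesis
    unfolding extension_step_def using even_symplectic_reduced by blast
qed

lemma extension_step_reduced: "extension_step reduced S"
  using double_extension_step gen_double_extension_step by (cases d) auto

end

section \<open>Existence of central isotropic elements\<close>

context even_symplectic
begin

lemma central_commute:
  assumes z: "z \<in> comp S p" and central: "\<And>x. x \<in> carrier S \<Longrightarrow> bracket S x z = 0"
    and x: "x \<in> carrier S"
  shows "bracket S z x = 0"
  using x
proof (induction rule: carrier_induct)
  case (homogeneous q x)
  then show ?case using bracket_skew[OF z homogeneous] central carrier_comp by simp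
next
  case (add u v)
  then show ?case by (simp add: bracket_add_right carrier_comp[OF z])
qed

lemma ex_hyperbolic_pair:
  assumes es: "es \<in> comp S d" "es \<noteq> 0" "form S es es = 0"
    and central: "\<And>x. x \<in> carrier S \<Longrightarrow> bracket S es x = 0"
  obtains e where "hyperbolic_pair S d es e"
proof -
  note es_car = carrier_comp[OF es(1)]
  obtain y where y: "y \<in> carrier S" "form S es y \<noteq> 0"
    using form_nondegenerate[OF es_car] es(2) by blast
  obtain u v where uv: "u \<in> comp S d" "v \<in> comp S (d + 1)" "y = u + v"
    using carrier_decompose[OF y(1)] by blast
  have "form S es v = 0"
    using form_even[OF es(1) uv(2)] by (cases d) simp_all
  then have nz: "form S es u \<noteq> 0"
    using y(2) es_car carrier_comp[OF uv(1)] carrier_comp[OF uv(2)] by (simp add: uv(3) form_add_right)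
  define w where "w = smul S (1 / form S es u) u"
  have w: "w \<in> comp S d" unfolding w_def using comp_scale uv(1) by blast
  note w_car = carrier_comp[OF w]
  have es_w: "form S es w = 1"
    unfolding w_def using nz es_car carrier_comp[OF uv(1)] by (simp add: form_scale_right)
  have w_es: "form S w es = - sg d" using form_swap[OF es(1) w_car] es_w by simp
  \<comment> \<open>For odd \<open>w\<close> the form is symmetric and \<open>\<omega>(w - t es, w - t es) = \<omega>(w, w) - 2 t\<close>.\<close>
  define e where "e = w - smul S (1 / 2 * form S w w) es"
  have e: "e \<in> comp S d" unfolding e_def using w es(1) comp_diff comp_scale by blast
  have "form S es e = 1"
    unfolding e_def using es_car w_car es_w es(3)
    by (simp add: form_diff_right form_scale_right carrier_scale)
  moreover have "form S e e = 0"
  proof (cases "d = 0")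
    case True
    then show ?thesis using form_even_self e by simp
  next
    case False
    then have "form S w es = 1" using w_es by (simp add: sg_def)
    then show ?thesis
      unfolding e_def using es_car w_car es_w es(3)
      by (simp add: form_diff_left form_scale_left form_diff_right form_scale_right carrier_scale
          carrier_diff)
  qed
  ultimately have "hyperbolic_pair S d es e"
    using es(1,3) e central by unfold_locales
  then show thesis by (rule that)
qed

text \<open>
  A nonzero homogeneous central \<open>z\<close> is odd, because even elements are isotropic. Its orthogonal \<open>P\<close> is a
  graded ideal. A nonzero homogeneous central \<open>w\<close> in \<open>P\<close> would be odd and anisotropic as well, and \<open>t\<close>
  with \<open>\<omega>(z, z) + t\<^sup>2 \<omega>(w, w) = 0\<close> would give the isotropic central element \<open>z + t w\<close>, nonzero because
  \<open>\<omega>(z, z + t w) = \<omega>(z, z) \<noteq> 0\<close>. So \<open>P\<close> is zero and \<open>z\<close> spans everything.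
\<close>

lemma in_U_of_anisotropic_center:
  assumes nil: "nilpotent S"
    and aniso: "\<And>p z. z \<in> comp S p \<Longrightarrow> (\<And>x. x \<in> carrier S \<Longrightarrow> bracket S x z = 0) \<Longrightarrow>
      form S z z = 0 \<Longrightarrow> z = 0"
  shows "in_U S"
proof (cases "carrier S = {0}")
  case True
  then show ?thesis unfolding in_U_def using lie_superalgebra_axioms by blast
next
  case False
  have "\<exists>p z. z \<in> comp S p \<and> z \<in> carrier S \<and> z \<noteq> 0 \<and> (\<forall>x\<in>carrier S. bracket S x z = 0)"
    using bracket_carrier carrier_comp
    by (intro nilpotent_ideal_meets_center[OF nil subspace_carrier order_refl False])
  then obtain p z where z: "z \<in> comp S p" "z \<noteq> 0" "\<And>x. x \<in> carrier S \<Longrightarrow> bracket S x z = 0"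
    by blast
  have z_car: "z \<in> carrier S" by (rule carrier_comp[OF z(1)])
  have zz: "form S z z \<noteq> 0" using aniso[OF z(1) z(3)] z(2) by blast
  then have "p \<noteq> 0" using form_even_self z(1) by blast
  then have z1: "z \<in> comp S 1" using z(1) by simp
  have z_left: "bracket S z x = 0" if "x \<in> carrier S" for x
    by (rule central_commute[OF z(1) z(3) that])
  define P where "P = {x \<in> carrier S. form S z x = 0}"
  have even_P: "u \<in> P" if "u \<in> comp S 0" for u
    using form_even[OF z1 that] carrier_comp[OF that] by (simp add: P_def)
  have "P = {0}"
  proof (rule ccontr)
    assume nonzero: "P \<noteq> {0}"
    have "subspace P"
      unfolding P_def
      by (rule subspaceI) (simp_all add: carrier_0 carrier_add carrier_scale zero_args z_car
          form_add_right form_scale_right)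
    moreover have "P \<subseteq> carrier S" unfolding P_def by blast
    moreover have "bracket S x y \<in> P" if "x \<in> carrier S" "y \<in> P" for x y
      using that form_bracket[OF z(1), of x y] z_left
      by (simp add: P_def bracket_carrier zero_args twist_carrier)
    ultimately have "\<exists>q w. w \<in> comp S q \<and> w \<in> P \<and> w \<noteq> 0 \<and> (\<forall>x\<in>carrier S. bracket S x w = 0)"
      using even_P by (intro nilpotent_ideal_meets_center[OF nil _ _ nonzero])
    then obtain q w where w: "w \<in> comp S q" "w \<in> P" "w \<noteq> 0"
      "\<And>x. x \<in> carrier S \<Longrightarrow> bracket S x w = 0"
      by blast
    have w_car: "w \<in> carrier S" by (rule carrier_comp[OF w(1)])
    have ww: "form S w w \<noteq> 0" using aniso[OF w(1) w(4)] w(3) by blast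
    then have "q \<noteq> 0" using form_even_self w(1) by blast
    then have w1: "w \<in> comp S 1" using w(1) by simp
    have zw: "form S z w = 0" using w(2) by (simp add: P_def)
    have wz: "form S w z = 0" using form_swap[OF z1 w_car] zw by simp
    obtain t where t: "t ^ 2 = - form S z z / form S w w"
      using nth_root_exists[of 2 "- form S z z / form S w w"] by auto
    define v where "v = z + smul S t w"
    have "v \<in> comp S 1" unfolding v_def using z1 w1 comp_add comp_scale by blast
    moreover have "bracket S x v = 0" if "x \<in> carrier S" for x
      unfolding v_def using that z_car w_car z(3) w(4)
      by (simp add: bracket_add_right bracket_scale_right carrier_scale)
    moreover have "form S v v = 0"
    proof -
      have "form S v v = form S z z + t ^ 2 * form S w w"
        unfolding v_def using z_car w_car zw wz
        by (simp add: form_add_left form_add_right form_scale_left form_scale_right carrier_scale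
            carrier_add power2_eq_square)
      then show ?thesis using t ww by simp
    qed
    ultimately have "v = 0" using aniso by blast
    moreover have "form S z v = form S z z"
      unfolding v_def using z_car w_car zw by (simp add: form_add_right form_scale_right carrier_scale)
    ultimately show False using zz zero_args(4)[OF z_car] by simp
  qed
  have "comp S 0 = {0}" using even_P \<open>P = {0}\<close> comp_0 by blast
  moreover have "comp S 1 = span {z}"
  proof
    show "span {z} \<subseteq> comp S 1" using z1 by (intro span_minimal subspace_comp) simp
    show "comp S 1 \<subseteq> span {z}"
    proof
      fix x assume "x \<in> comp S 1"
      then have x: "x \<in> carrier S" by (rule carrier_comp)
      let ?c = "form S z x / form S z z"
      have "x - smul S ?c z \<in> P"
        unfolding P_def using x z_car zz
        by (simp add: form_diff_right form_scale_right carrier_diff carrier_scale)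
      then have "x = smul S ?c z" using \<open>P = {0}\<close> by simp
      then show "x \<in> span {z}" using span_scale[OF span_base[of z "{z}"], of ?c] by simp
    qed
  qed
  moreover have "dim (span {z}) = 1"
  proof -
    have "independent {z}" using z(2) by (simp add: dependent_single)
    then show ?thesis using dim_span_eq_card_independent by fastforce
  qed
  ultimately show ?thesis unfolding in_U_def using lie_superalgebra_axioms by simp
qed

end

section \<open>Induction on the dimension\<close>

theorem corollary3p11:
  fixes G :: "('k::{alg_closed_field, field_char_0}, 'a::ab_group_add) symp_superalg"
  assumes "even_symplectic G"
    and "nilpotent G"
  shows "in_U G \<or>
    (\<exists>H :: ('k, 'a) symp_superalg. even_symplectic H \<and> in_U H \<and> extension_step\<^sup>+\<^sup>+ H G)"
  using assms
proof (induction "vector_space.dim (smul G) (carrier G)" arbitrary: G rule: less_induct)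
  case (less G)
  interpret even_symplectic G by (rule less.prems(1))
  show ?case
  proof (cases "in_U G")
    case False
    then obtain p z where z: "z \<in> comp G p" "\<And>x. x \<in> carrier G \<Longrightarrow> bracket G x z = 0"
      "form G z z = 0" "z \<noteq> 0"
      using in_U_of_anisotropic_center[OF less.prems(2)] by blast
    obtain e where "hyperbolic_pair G p z e"
      by (rule ex_hyperbolic_pair[OF z(1,4,3) central_commute[OF z(1,2)]])
    then interpret hyperbolic_pair G p z e .
    have step: "extension_step reduced G" by (rule extension_step_reduced)
    have "in_U reduced \<or> (\<exists>H :: ('k, 'a) symp_superalg.
        even_symplectic H \<and> in_U H \<and> extension_step\<^sup>+\<^sup>+ H reduced)"
      using less.hyps[of reduced] dim_reduced even_symplectic_reduced
        nilpotent_reduced[OF less.prems(2)] by simp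
    then show ?thesis
    proof
      assume "in_U reduced"
      then show ?thesis using even_symplectic_reduced step by blast
    next
      assume "\<exists>H :: ('k, 'a) symp_superalg.
        even_symplectic H \<and> in_U H \<and> extension_step\<^sup>+\<^sup>+ H reduced"
      then show ?thesis using step tranclp.trancl_into_trancl by metis
    qed
  qed simp
qed

end
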